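(* Let $d\ge2$, let $X=(X^1,\dots,X^d)$ be a random element of $\mathcal X=\mathcal X^1\times\cdots\times\mathcal X^d$ whose distribution satisfies $\mathbb P_X\ne\mathbb P_{X^1}\times\cdots\times\mathbb P_{X^d}$, let $X_1,X_2,\dots$ be i.i.d. copies of $X$, and for each $n$ let $D=(X_1,\dots,X_n)$. Assume the kernel $k=k^1\otimes\cdots\otimes k^d$ on $\mathcal X$ is characteristic, and that there is a constant $C>0$ such that for all $n\ge 2d$ and all $(i_1,\dots,i_{2d})\in\{1,\dots,n\}^{2d}$, $$\mathbb E\left|\prod_{j=1}^dk^j\left(X^j_{i_{2j-1}},X^j_{i_{2j}}\right)\right|<C.$$ Let $$p_D=\frac{1}{(n!)^{d-1}}\,\#\left\{\psi:\ \widehat{\mathrm{dHSIC}}(\psi D)\ge\widehat{\mathrm{dHSIC}}(D)\right\}$$ be the $p$-value of the permutation test using all $(n!)^{d-1}$ vectors $\psi$ of $d-1$ permutations of $\{1,\dots,n\}$. Then $p_D\to0$ in probability as $n\to\infty$. In particular the test is consistent: for every level $\alpha\in(0,1)$, the probability $\mathbb P(p_D\le\alpha)$ of rejecting the null hypothesis of joint independence converges to $1$ as $n\to\infty$.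
   Context: Setting. For $i=1,\dots,d$, $\mathcal X^i$ is a locally compact metric space with its Borel sigma-algebra; $\mathcal X=\mathcal X^1\times\cdots\times\mathcal X^d$ carries the product sigma-algebra. $X^i$ is an $\mathcal X^i$-valued random variable, all $X^i$ being defined on one probability space. Superscripts on $X$, $x$, $k$ and $\psi$ are indices, never powers. Each $k^i:\mathcal X^i\times\mathcal X^i\to\mathbb R$ is a $c_0$-universal kernel, meaning that it is continuous and its reproducing kernel Hilbert space (RKHS) is (contained and) dense, in the uniform norm, in $C_0(\mathcal X^i)$, the continuous functions vanishing at infinity. The tensor product kernel is $k(x,y)=\prod_{j=1}^dk^j(x^j,y^j)$, with RKHS $\mathcal H_k$. The mean embedding of a probability measure $\mathbb P$ on $\mathcal X$ is the element $\mu_{\mathbb P}\in\mathcal H_k$ with $\int f\,d\mathbb P=\langle f,\mu_{\mathbb P}\rangle$ for all $f\in\mathcal H_k$; $k$ is characteristic if $\|\mu_{\mathbb P}-\mu_{\mathbb Q}\|_{\mathcal H_k}=0$ if and only if $\mathbb P=\mathbb Q$. Estimator. With $M_q(n)=\{1,\dots,n\}^q$ and $D=(x_1,\dots,x_n)\in\mathcal X^n$, $x_i=(x_i^1,\dots,x_i^d)$, $$\widehat{\mathrm{dHSIC}}(D)=\frac{1}{n^2}\sum_{(i_1,i_2)\in M_2(n)}\prod_{j=1}^dk^j(x^j_{i_1},x^j_{i_2})+\frac{1}{n^{2d}}\sum_{(i_1,\dots,i_{2d})\in M_{2d}(n)}\prod_{j=1}^dk^j(x^j_{i_{2j-1}},x^j_{i_{2j}})-\frac{2}{n^{d+1}}\sum_{(i_1,\dots,i_{d+1})\in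 M_{d+1}(n)}\prod_{j=1}^dk^j(x^j_{i_1},x^j_{i_{j+1}}).$$ Permuted data. For a vector $\psi=(\psi^1,\dots,\psi^{d-1})$ of permutations of $\{1,\dots,n\}$, $\psi D$ is the dataset whose $i$-th point is $(x^1_i,x^2_{\psi^1(i)},\dots,x^d_{\psi^{d-1}(i)})$, $i=1,\dots,n$. The test of level $\alpha$ rejects the null hypothesis of joint independence if and only if $p_D\le\alpha$. Ties are broken conservatively, i.e. every permuted statistic equal to the original one is counted in $p_D$. *)

theory Defs
  imports "HOL-Probability.Probability"
begin

section \<open>Reproducing kernel Hilbert spaces\<close>

text \<open>A function on a carrier \<open>S\<close> is represented by its extension by \<open>0\<close> to the whole type, so that
  pointwise operations stay inside the representation and equality is equality on \<open>S\<close>.\<close>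

definition kernel_section :: "'x set \<Rightarrow> ('x \<Rightarrow> 'x \<Rightarrow> real) \<Rightarrow> 'x \<Rightarrow> 'x \<Rightarrow> real" where
  "kernel_section S k x = (\<lambda>y. if y \<in> S then k x y else 0)"

text \<open>\<open>is_rkhs S k H ip\<close>: the function space \<open>H\<close> with inner product \<open>ip\<close> is the RKHS on \<open>S\<close> with
  reproducing kernel \<open>k\<close>. On \<open>S\<close>, \<open>k\<close> determines \<open>H\<close> and the values of \<open>ip\<close> on \<open>H\<close> uniquely (so
  \<open>\<exists>H ip\<close> below speaks about \<^emph>\<open>the\<close> RKHS), and existence of such a pair is equivalent to \<open>k\<close> being
  symmetric and positive semidefinite. Values of \<open>ip\<close> off \<open>H\<close> are irrelevant.\<close>

definition is_rkhs ::
  "'x set \<Rightarrow> ('x \<Rightarrow> 'x \<Rightarrow> real) \<Rightarrow> ('x \<Rightarrow> real) set \<Rightarrow> (('x \<Rightarrow> real) \<Rightarrow> ('x \<Rightarrow> real) \<Rightarrow> real) \<Rightarrow> bool"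
where
  "is_rkhs S k H ip \<longleftrightarrow>
     (\<forall>f\<in>H. \<forall>x. x \<notin> S \<longrightarrow> f x = 0) \<and>
     (\<lambda>x. 0) \<in> H \<and>
     (\<forall>f\<in>H. \<forall>g\<in>H. (\<lambda>x. f x + g x) \<in> H) \<and>
     (\<forall>c. \<forall>f\<in>H. (\<lambda>x. c * f x) \<in> H) \<and>
     (\<forall>f\<in>H. \<forall>g\<in>H. ip f g = ip g f) \<and>
     (\<forall>f\<in>H. \<forall>g\<in>H. \<forall>h\<in>H. ip (\<lambda>x. f x + g x) h = ip f h + ip g h) \<and>
     (\<forall>c. \<forall>f\<in>H. \<forall>g\<in>H. ip (\<lambda>x. c * f x) g = c * ip f g) \<and>
     (\<forall>f\<in>H. 0 \<le> ip f f) \<and>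
     (\<forall>f\<in>H. ip f f = 0 \<longrightarrow> f = (\<lambda>x. 0)) \<and>
     Metric_space.mcomplete H (\<lambda>f g. sqrt (ip (\<lambda>x. f x - g x) (\<lambda>x. f x - g x))) \<and>
     (\<forall>x\<in>S. kernel_section S k x \<in> H) \<and>
     (\<forall>x\<in>S. \<forall>f\<in>H. ip f (kernel_section S k x) = f x)"

section \<open>Universal and characteristic kernels\<close>

definition C0_space :: "'x topology \<Rightarrow> ('x \<Rightarrow> real) set" where
  "C0_space T = {f. (\<forall>x. x \<notin> topspace T \<longrightarrow> f x = 0) \<and>
     continuous_map T euclideanreal f \<and>
     (\<forall>\<epsilon>>0. compactin T {x \<in> topspace T. \<epsilon> \<le> \<bar>f x\<bar>})}"

definition c0_universal :: "'x topology \<Rightarrow> ('x \<Rightarrow> 'x \<Rightarrow> real) \<Rightarrow> bool" where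
  "c0_universal T k \<longleftrightarrow>
     continuous_map (prod_topology T T) euclideanreal (\<lambda>(x, y). k x y) \<and>
     (\<exists>H ip. is_rkhs (topspace T) k H ip \<and> H \<subseteq> C0_space T \<and>
        (\<forall>g\<in>C0_space T. \<forall>\<epsilon>>0. \<exists>f\<in>H. \<forall>x\<in>topspace T. \<bar>f x - g x\<bar> \<le> \<epsilon>))"

definition mean_embedding ::
  "('x \<Rightarrow> real) set \<Rightarrow> (('x \<Rightarrow> real) \<Rightarrow> ('x \<Rightarrow> real) \<Rightarrow> real) \<Rightarrow> 'x measure \<Rightarrow> ('x \<Rightarrow> real) \<Rightarrow> bool"
where
  "mean_embedding H ip P \<mu> \<longleftrightarrow>
     \<mu> \<in> H \<and> (\<forall>f\<in>H. integrable P f \<and> (\<integral>x. f x \<partial>P) = ip f \<mu>)"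

text \<open>The measurable space is given by the measure \<open>K\<close>, of which only carrier and sigma-algebra
  matter. As usual, the notion includes that every probability measure has a mean embedding, which
  is automatic for bounded kernels with measurable sections.\<close>

definition characteristic_kernel :: "'x measure \<Rightarrow> ('x \<Rightarrow> 'x \<Rightarrow> real) \<Rightarrow> bool" where
  "characteristic_kernel K k \<longleftrightarrow>
     (\<exists>H ip. is_rkhs (space K) k H ip \<and>
        (\<forall>P. prob_space P \<and> sets P = sets K \<longrightarrow> (\<exists>\<mu>. mean_embedding H ip P \<mu>)) \<and>
        (\<forall>P Q \<mu> \<nu>. prob_space P \<and> sets P = sets K \<and> prob_space Q \<and> sets Q = sets K \<and>
            mean_embedding H ip P \<mu> \<and> mean_embedding H ip Q \<nu> \<longrightarrow>
            (sqrt (ip (\<lambda>x. \<mu> x - \<nu> x) (\<lambda>x. \<mu> x - \<nu> x)) = 0 \<longleftrightarrow> P = Q)))"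

text \<open>The factors of the product are subsets of one type; since they carry their own metrics or
  topologies, arbitrary families are covered by passing to a sum type. Points of the product are
  functions on \<open>{1..d}\<close>.\<close>

definition tensor_kernel ::
  "nat \<Rightarrow> (nat \<Rightarrow> 'a \<Rightarrow> 'a \<Rightarrow> real) \<Rightarrow> (nat \<Rightarrow> 'a) \<Rightarrow> (nat \<Rightarrow> 'a) \<Rightarrow> real" where
  "tensor_kernel d k x y = (\<Prod>j = 1..d. k j (x j) (y j))"

definition borel_of_topology :: "'x topology \<Rightarrow> 'x measure" where
  "borel_of_topology T = sigma (topspace T) {U. openin T U}"

section \<open>The estimator and the permutation test\<close>

definition index_tuples :: "nat \<Rightarrow> nat \<Rightarrow> (nat \<Rightarrow> nat) set" where
  "index_tuples q n = {1..q} \<rightarrow>\<^sub>E {1..n}"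

text \<open>\<open>D i j\<close> is the \<open>j\<close>-th component of the \<open>i\<close>-th data point; both indices start from \<open>1\<close>.\<close>

definition dHSIC_hat ::
  "nat \<Rightarrow> (nat \<Rightarrow> 'a \<Rightarrow> 'a \<Rightarrow> real) \<Rightarrow> nat \<Rightarrow> (nat \<Rightarrow> nat \<Rightarrow> 'a) \<Rightarrow> real" where
  "dHSIC_hat d k n D =
     1 / real n ^ 2 *
       (\<Sum>i\<in>index_tuples 2 n. \<Prod>j = 1..d. k j (D (i 1) j) (D (i 2) j))
     + 1 / real n ^ (2 * d) *
       (\<Sum>i\<in>index_tuples (2 * d) n. \<Prod>j = 1..d. k j (D (i (2 * j - 1)) j) (D (i (2 * j)) j))
     - 2 / real n ^ (d + 1) *
       (\<Sum>i\<in>index_tuples (d + 1) n. \<Prod>j = 1..d. k j (D (i 1) j) (D (i (j + 1)) j))"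

definition permutation_vectors :: "nat \<Rightarrow> nat \<Rightarrow> (nat \<Rightarrow> nat \<Rightarrow> nat) set" where
  "permutation_vectors d n = {1..d - 1} \<rightarrow>\<^sub>E {\<sigma>. \<sigma> permutes {1..n}}"

definition permuted_data ::
  "(nat \<Rightarrow> nat \<Rightarrow> nat) \<Rightarrow> (nat \<Rightarrow> nat \<Rightarrow> 'a) \<Rightarrow> nat \<Rightarrow> nat \<Rightarrow> 'a" where
  "permuted_data \<psi> D = (\<lambda>i j. if j = 1 then D i 1 else D (\<psi> (j - 1) i) j)"

definition perm_p_value ::
  "nat \<Rightarrow> (nat \<Rightarrow> 'a \<Rightarrow> 'a \<Rightarrow> real) \<Rightarrow> nat \<Rightarrow> (nat \<Rightarrow> nat \<Rightarrow> 'a) \<Rightarrow> real" where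
  "perm_p_value d k n D =
     1 / (fact n) ^ (d - 1) *
       real (card {\<psi> \<in> permutation_vectors d n.
                     dHSIC_hat d k n (permuted_data \<psi> D) \<ge> dHSIC_hat d k n D})"

definition perm_test_rejects ::
  "real \<Rightarrow> nat \<Rightarrow> (nat \<Rightarrow> 'a \<Rightarrow> 'a \<Rightarrow> real) \<Rightarrow> nat \<Rightarrow> (nat \<Rightarrow> nat \<Rightarrow> 'a) \<Rightarrow> bool" where
  "perm_test_rejects \<alpha> d k n D \<longleftrightarrow> perm_p_value d k n D \<le> \<alpha>"

definition converges_in_probability ::
  "'w measure \<Rightarrow> (nat \<Rightarrow> 'w \<Rightarrow> real) \<Rightarrow> real \<Rightarrow> bool" where
  "converges_in_probability M Y c \<longleftrightarrow>
     (\<forall>n. Y n \<in> borel_measurable M) \<and>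
     (\<forall>\<epsilon>>0. (\<lambda>n. measure M {\<omega> \<in> space M. \<epsilon> < \<bar>Y n \<omega> - c\<bar>}) \<longlonglongrightarrow> 0)"

end

theory Submission
  imports Defs
begin

text \<open>With \<open>P\<close> the law of \<open>X\<close>, \<open>dHSIC_hat D\<close> is the squared RKHS distance between the
  embeddings of the empirical measure and of the product of its marginals. Evaluating their
  difference at a point where the embeddings of \<open>P\<close> and of the product of the marginals of \<open>P\<close>
  differ bounds \<open>dHSIC_hat D\<close> from below by a positive constant with probability tending
  to \<open>1\<close>; only averages of the bounded functions \<open>k j (x j)\<close> enter, so Hoeffding's inequality
  suffices. For a uniformly random \<open>\<psi>\<close>, each of the three sums in \<open>dHSIC_hat (\<psi> D)\<close> evaluates the
  kernels at \<open>2 * d\<close> data indices that are distinct up to probability \<open>O(1/n)\<close>. On distinct indices the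
  expectation is one constant \<open>a\<close>, and \<open>a + a - 2 * a = 0\<close>, so the mean of \<open>dHSIC_hat (\<psi> D)\<close> over \<open>\<psi>\<close> and
  \<open>D\<close> is \<open>O(1/n)\<close>. Markov's inequality over \<open>\<psi>\<close> then bounds the \<open>p\<close>-value.

  The spaces need not be separable, so the kernels need not be measurable for the product
  \<open>\<sigma>\<close>-algebra. They are so almost surely: a component law not concentrated on a \<open>\<sigma>\<close>-compact
  set yields distinct measures with embedding \<open>0\<close>, contradicting that the kernel is characteristic.\<close>

section \<open>Reproducing kernel Hilbert spaces\<close>

locale rkhs =
  fixes S :: "'x set" and k :: "'x \<Rightarrow> 'x \<Rightarrow> real" and H :: "('x \<Rightarrow> real) set"
    and ip :: "('x \<Rightarrow> real) \<Rightarrow> ('x \<Rightarrow> real) \<Rightarrow> real"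
  assumes is_rkhs: "is_rkhs S k H ip"
begin

lemma zero_in: "(\<lambda>x. 0) \<in> H"
  and add_in: "f \<in> H \<Longrightarrow> g \<in> H \<Longrightarrow> (\<lambda>x. f x + g x) \<in> H"
  and scale_in: "f \<in> H \<Longrightarrow> (\<lambda>x. c * f x) \<in> H"
  and ip_sym: "f \<in> H \<Longrightarrow> g \<in> H \<Longrightarrow> ip f g = ip g f"
  and ip_add: "f \<in> H \<Longrightarrow> g \<in> H \<Longrightarrow> h \<in> H \<Longrightarrow> ip (\<lambda>x. f x + g x) h = ip f h + ip g h"
  and ip_scale: "f \<in> H \<Longrightarrow> g \<in> H \<Longrightarrow> ip (\<lambda>x. c * f x) g = c * ip f g"
  and ip_nonneg: "f \<in> H \<Longrightarrow> 0 \<le> ip f f"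
  and ip_zeroD: "f \<in> H \<Longrightarrow> ip f f = 0 \<Longrightarrow> f = (\<lambda>x. 0)"
  and section_in: "x \<in> S \<Longrightarrow> kernel_section S k x \<in> H"
  and reproducing: "x \<in> S \<Longrightarrow> f \<in> H \<Longrightarrow> ip f (kernel_section S k x) = f x"
  and outside: "f \<in> H \<Longrightarrow> x \<notin> S \<Longrightarrow> f x = 0"
  using is_rkhs unfolding is_rkhs_def by blast+

lemma ip_zero: "ip (\<lambda>x. 0) (\<lambda>x. 0) = 0"
  using ip_scale[OF zero_in zero_in, of 0] by simp

lemma diff_in: "f \<in> H \<Longrightarrow> g \<in> H \<Longrightarrow> (\<lambda>x. f x - g x) \<in> H"
  using add_in[OF _ scale_in[of g "-1"], of f] by simp

lemma ip_diff: "f \<in> H \<Longrightarrow> g \<in> H \<Longrightarrow> h \<in> H \<Longrightarrow> ip (\<lambda>x. f x - g x) h = ip f h - ip g h"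
  using ip_add[OF _ scale_in[of g "-1"], of f h] ip_scale[of g h "-1"] by simp

lemma kernel_sym:
  assumes "x \<in> S" "y \<in> S" shows "k x y = k y x"
  using reproducing[OF assms(1) section_in[OF assms(2)]]
    reproducing[OF assms(2) section_in[OF assms(1)]]
    ip_sym[OF section_in[OF assms(1)] section_in[OF assms(2)]] assms
  by (simp add: kernel_section_def)

text \<open>Cauchy-Schwarz for \<open>f\<close> against the section at \<open>x\<close>: the
  reproducing property turns the inner product into \<open>f x\<close> and the squared norm of the
  section into \<open>k x x\<close>.\<close>

lemma eval_le:
  assumes f: "f \<in> H" and x: "x \<in> S"
  shows "(f x)\<^sup>2 \<le> ip f f * k x x"
proof -
  let ?s = "kernel_section S k x"
  note s = section_in[OF x]
  \<comment> \<open>Expansion of the nonnegative squared norm of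
    \<open>a * f - b * ?s\<close>.\<close>
  have key: "0 \<le> a\<^sup>2 * ip f f - 2 * a * b * f x + b\<^sup>2 * k x x" for a b
  proof -
    let ?g = "\<lambda>y. a * f y - b * ?s y"
    have g: "?g \<in> H" using f s by (intro diff_in scale_in)
    have ipg: "ip ?g h = a * ip f h - b * ip ?s h" if "h \<in> H" for h
      using f s that by (simp add: ip_diff ip_scale scale_in)
    have sf: "ip ?s f = f x" using ip_sym[OF s f] reproducing[OF x f] by simp
    have ss: "ip ?s ?s = k x x" using reproducing[OF x s] x by (simp add: kernel_section_def)
    have "ip ?g ?g = a * ip ?g f - b * ip ?g ?s"
      using ipg[OF g] ip_sym[OF f g] ip_sym[OF s g] by simp
    then have "ip ?g ?g = a * (a * ip f f - b * f x) - b * (a * f x - b * k x x)"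
      using ipg[OF f] ipg[OF s] sf ss reproducing[OF x f] by simp
    moreover have "0 \<le> ip ?g ?g"
      by (rule ip_nonneg[OF g])
    ultimately show ?thesis by (simp add: algebra_simps power2_eq_square)
  qed
  show ?thesis
  proof (cases "ip f f = 0")
    case True
    then show ?thesis using ip_zeroD[OF f] by simp
  next
    case False
    then have pos: "0 < ip f f" using ip_nonneg[OF f] by simp
    \<comment> \<open>The ratio \<open>a / b = f x / ip f f\<close> minimises the quadratic form of
      \<open>key\<close>; scaling by \<open>ip f f\<close> avoids the division.\<close>
    have "0 \<le> ip f f * (ip f f * k x x - (f x)\<^sup>2)"
      using key[of "f x" "ip f f"] by (simp add: algebra_simps power2_eq_square)
    then show ?thesis using pos by (simp add: zero_le_mult_iff)
  qed
qed

text \<open>The sum of sections is the unnormalised embedding of the counting measure of the points;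
  indexing by \<open>I\<close> lets repeated points count with multiplicity.\<close>

lemma finite_combination:
  assumes "finite I" and z: "\<And>i. i \<in> I \<Longrightarrow> z i \<in> S"
  shows "(\<lambda>y. \<Sum>i\<in>I. kernel_section S k (z i) y) \<in> H"
    and "f \<in> H \<Longrightarrow> ip (\<lambda>y. \<Sum>i\<in>I. kernel_section S k (z i) y) f = (\<Sum>i\<in>I. f (z i))"
proof -
  have "(\<lambda>y. \<Sum>i\<in>I. kernel_section S k (z i) y) \<in> H \<and>
    (\<forall>f\<in>H. ip (\<lambda>y. \<Sum>i\<in>I. kernel_section S k (z i) y) f = (\<Sum>i\<in>I. f (z i)))"
    using assms
  proof (induction I rule: finite_induct)
    case empty
    then show ?case using zero_in ip_scale[OF zero_in, of _ 0] by simp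
  next
    case (insert i I)
    then have s: "kernel_section S k (z i) \<in> H" by (simp add: section_in)
    show ?case
      using insert s by (simp add: add_in ip_add reproducing ip_sym[OF s])
  qed
  then show "(\<lambda>y. \<Sum>i\<in>I. kernel_section S k (z i) y) \<in> H"
    and "f \<in> H \<Longrightarrow> ip (\<lambda>y. \<Sum>i\<in>I. kernel_section S k (z i) y) f = (\<Sum>i\<in>I. f (z i))"
    by auto
qed

text \<open>\<open>Q\<close> is the squared norm of the difference of two weighted empirical embeddings.\<close>

lemma empirical_distance:
  fixes a b :: real
  assumes I: "finite I" "\<And>i. i \<in> I \<Longrightarrow> z i \<in> S" and J: "finite J" "\<And>i. i \<in> J \<Longrightarrow> w i \<in> S"
  defines "Q \<equiv> a\<^sup>2 * (\<Sum>i\<in>I. \<Sum>i'\<in>I. k (z i) (z i')) + b\<^sup>2 * (\<Sum>i\<in>J. \<Sum>i'\<in>J. k (w i) (w i'))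
    - 2 * a * b * (\<Sum>i\<in>I. \<Sum>i'\<in>J. k (z i) (w i'))"
  shows "0 \<le> Q"
    and "x \<in> S \<Longrightarrow> (a * (\<Sum>i\<in>I. k x (z i)) - b * (\<Sum>i\<in>J. k x (w i)))\<^sup>2 \<le> Q * k x x"
proof -
  define F where "F = (\<lambda>y. \<Sum>i\<in>I. kernel_section S k (z i) y)"
  define G where "G = (\<lambda>y. \<Sum>i\<in>J. kernel_section S k (w i) y)"
  define g where "g = (\<lambda>y. a * F y - b * G y)"
  have FG: "F \<in> H" "G \<in> H" unfolding F_def G_def using I J by (simp_all add: finite_combination)
  then have g: "g \<in> H" unfolding g_def by (intro diff_in scale_in)
  \<comment> \<open>Pairing with \<open>g\<close> integrates against a signed discrete measure, so
    \<open>ip g g\<close> is obtained by summing \<open>g\<close> itself over the points;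
    \<open>A1\<close> and \<open>A2\<close> compute the two sums.\<close>
  have ipg: "ip g f = a * (\<Sum>i\<in>I. f (z i)) - b * (\<Sum>i\<in>J. f (w i))" if "f \<in> H" for f
    using FG that I J unfolding g_def F_def G_def
    by (simp add: ip_diff ip_scale scale_in finite_combination)
  have val: "g y = a * (\<Sum>i\<in>I. k (z i) y) - b * (\<Sum>i\<in>J. k (w i) y)" if "y \<in> S" for y
    using that by (simp add: g_def F_def G_def kernel_section_def)
  have sym: "k (w i) (z i') = k (z i') (w i)" if "i \<in> J" "i' \<in> I" for i i'
    using that I J by (simp add: kernel_sym)
  have A1: "(\<Sum>i\<in>I. g (z i)) = a * (\<Sum>i\<in>I. \<Sum>i'\<in>I. k (z i) (z i')) - b * (\<Sum>i\<in>I. \<Sum>i'\<in>J. k (z i) (w i'))"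
  proof -
    have "(\<Sum>i\<in>I. g (z i)) = (\<Sum>i\<in>I. a * (\<Sum>i'\<in>I. k (z i') (z i)) - b * (\<Sum>i'\<in>J. k (z i) (w i')))"
      using I(2) J(2) by (intro sum.cong) (simp_all add: val sym)
    then show ?thesis
      by (simp add: sum_subtractf sum_distrib_left[symmetric] sum.swap[of "\<lambda>i i'. k (z i') (z i)" I I])
  qed
  have A2: "(\<Sum>i\<in>J. g (w i)) = a * (\<Sum>i\<in>I. \<Sum>i'\<in>J. k (z i) (w i')) - b * (\<Sum>i\<in>J. \<Sum>i'\<in>J. k (w i) (w i'))"
  proof -
    have "(\<Sum>i\<in>J. g (w i)) = (\<Sum>i\<in>J. a * (\<Sum>i'\<in>I. k (z i') (w i)) - b * (\<Sum>i'\<in>J. k (w i') (w i)))"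
      using I(2) J(2) by (intro sum.cong) (simp_all add: val)
    then show ?thesis
      by (simp add: sum_subtractf sum_distrib_left[symmetric] sum.swap[of "\<lambda>i i'. k (w i') (w i)" J J]
          sum.swap[of "\<lambda>i i'. k (z i') (w i)" I J])
  qed
  have Q: "Q = ip g g"
    unfolding ipg[OF g] A1 A2 Q_def by (simp add: algebra_simps power2_eq_square)
  show "0 \<le> Q" unfolding Q by (rule ip_nonneg[OF g])
  assume x: "x \<in> S"
  have "g x = a * (\<Sum>i\<in>I. k x (z i)) - b * (\<Sum>i\<in>J. k x (w i))"
    using x I J by (simp add: val kernel_sym[of x])
  then show "(a * (\<Sum>i\<in>I. k x (z i)) - b * (\<Sum>i\<in>J. k x (w i)))\<^sup>2 \<le> Q * k x x"
    using eval_le[OF g x] Q by simp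
qed

end

section \<open>The estimator as a squared RKHS distance\<close>

lemma tensor_kernel_cong:
  "(\<And>j. j \<in> {1..d} \<Longrightarrow> x j = x' j) \<Longrightarrow> (\<And>j. j \<in> {1..d} \<Longrightarrow> y j = y' j) \<Longrightarrow>
    tensor_kernel d k x y = tensor_kernel d k x' y'"
  unfolding tensor_kernel_def by (intro prod.cong) auto

lemma sum_index_tuples_2:
  "(\<Sum>i\<in>index_tuples 2 n. f (i 1) (i 2)) = (\<Sum>a\<in>{1..n}. \<Sum>b\<in>{1..n}. f a b)" for f :: "nat \<Rightarrow> nat \<Rightarrow> real"
proof -
  have "(\<Sum>a\<in>{1..n}. \<Sum>b\<in>{1..n}. f a b) = (\<Sum>(a,b)\<in>{1..n} \<times> {1..n}. f a b)"
    by (simp add: sum.cartesian_product)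
  also have "\<dots> = (\<Sum>i\<in>index_tuples 2 n. f (i 1) (i 2))"
    unfolding index_tuples_def
  proof (rule sum.reindex_bij_witness[of _ "\<lambda>i. (i 1, i 2)"
        "\<lambda>(a,b). \<lambda>m\<in>{1..2}. if m = 1 then a else b"], goal_cases)
    case (3 i)
    have "(\<lambda>m\<in>{1..2}. if m = 1 then i 1 else i 2) m = i m" for m
    proof (cases "m \<in> {1..2}")
      case True
      then have "m = 1 \<or> m = 2" by auto
      then show ?thesis by auto
    qed (use 3 in \<open>auto simp: PiE_iff extensional_def\<close>)
    then show ?case unfolding prod.case by (rule ext)
  qed (auto simp: PiE_iff)
  finally show ?thesis by simp
qed

text \<open>Odd slots of a \<open>2 * d\<close>-tuple form one \<open>d\<close>-tuple and even slots
  another, so the second sum of the estimator becomes a double sum over two independent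
  tuples.\<close>

lemma sum_index_tuples_double:
  fixes f :: "(nat \<Rightarrow> nat) \<Rightarrow> (nat \<Rightarrow> nat) \<Rightarrow> real"
  shows "(\<Sum>i\<in>index_tuples (2 * d) n. f (\<lambda>j\<in>{1..d}. i (2 * j - 1)) (\<lambda>j\<in>{1..d}. i (2 * j)))
    = (\<Sum>a\<in>index_tuples d n. \<Sum>b\<in>index_tuples d n. f a b)"
proof -
  have "(\<Sum>a\<in>index_tuples d n. \<Sum>b\<in>index_tuples d n. f a b) =
      (\<Sum>(a,b)\<in>index_tuples d n \<times> index_tuples d n. f a b)"
    by (simp add: sum.cartesian_product)
  also have "\<dots> = (\<Sum>i\<in>index_tuples (2 * d) n. f (\<lambda>j\<in>{1..d}. i (2 * j - 1)) (\<lambda>j\<in>{1..d}. i (2 * j)))"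
    unfolding index_tuples_def
  proof (rule sum.reindex_bij_witness[of _
        "\<lambda>i. (\<lambda>j\<in>{1..d}. i (2 * j - 1), \<lambda>j\<in>{1..d}. i (2 * j))"
        "\<lambda>(a,b). \<lambda>m\<in>{1..2*d}. if odd m then a ((m + 1) div 2) else b (m div 2)"], goal_cases)
    case (1 p)
    have "Suc (2 * j) - 1 = 2 * j" for j by simp
    with 1 show ?case
      by (auto simp: PiE_iff extensional_def fun_eq_iff)
  next
    case (3 i)
    have "(\<lambda>m\<in>{1..2*d}. if odd m then (\<lambda>j\<in>{1..d}. i (2 * j - 1)) ((m + 1) div 2)
        else (\<lambda>j\<in>{1..d}. i (2 * j)) (m div 2)) m = i m" for m
    proof (cases "m \<in> {1..2*d}")
      case True
      then show ?thesis by (cases "odd m") (auto elim!: oddE evenE)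
    qed (use 3 in \<open>auto simp: PiE_iff extensional_def\<close>)
    then show ?case unfolding prod.case by (rule ext)
  next
    case (4 i)
    then have "i \<in> {1..2*d} \<rightarrow>\<^sub>E {1..n}" by simp
    then have "i (2 * j - 1) \<in> {1..n}" "i (2 * j) \<in> {1..n}" if "j \<in> {1..d}" for j
      by (rule PiE_mem, use that in force)+
    then show ?case by (simp del: atLeastAtMost_iff)
  next
    case (2 p)
    then show ?case by (auto simp: PiE_iff elim!: oddE evenE)
  next
    case (5 p)
    then obtain a b where p: "p = (a, b)" and ab: "a \<in> {1..d} \<rightarrow>\<^sub>E {1..n}" "b \<in> {1..d} \<rightarrow>\<^sub>E {1..n}" by auto
    let ?c = "\<lambda>m\<in>{1..2*d}. if odd m then a ((m + 1) div 2) else b (m div 2)"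
    have "(\<lambda>j\<in>{1..d}. ?c (2 * j - 1)) = (\<lambda>j\<in>{1..d}. a j)"
      by (auto simp: fun_eq_iff)
    moreover have "(\<lambda>j\<in>{1..d}. ?c (2 * j)) = (\<lambda>j\<in>{1..d}. b j)"
      by (auto simp: fun_eq_iff)
    ultimately show ?case using ab by (simp add: p PiE_restrict)
  qed
  finally show ?thesis by simp
qed

lemma sum_index_tuples_Suc:
  fixes f :: "nat \<Rightarrow> (nat \<Rightarrow> nat) \<Rightarrow> real"
  shows "(\<Sum>i\<in>index_tuples (d + 1) n. f (i 1) (\<lambda>j\<in>{1..d}. i (j + 1)))
    = (\<Sum>a\<in>{1..n}. \<Sum>b\<in>index_tuples d n. f a b)"
proof -
  have "(\<Sum>a\<in>{1..n}. \<Sum>b\<in>index_tuples d n. f a b) =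
      (\<Sum>(a,b)\<in>{1..n} \<times> index_tuples d n. f a b)"
    by (simp add: sum.cartesian_product)
  also have "\<dots> = (\<Sum>i\<in>index_tuples (d + 1) n. f (i 1) (\<lambda>j\<in>{1..d}. i (j + 1)))"
    unfolding index_tuples_def
  proof (rule sum.reindex_bij_witness[of _
        "\<lambda>i. (i 1, \<lambda>j\<in>{1..d}. i (j + 1))"
        "\<lambda>(a,b). \<lambda>m\<in>{1..d+1}. if m = 1 then a else b (m - 1)"], goal_cases)
    case (1 p)
    then show ?case by (auto simp: PiE_iff extensional_def fun_eq_iff)
  next
    case (2 p)
    then obtain a b where p: "p = (a, b)" and a: "a \<in> {1..n}" and b: "b \<in> {1..d} \<rightarrow>\<^sub>E {1..n}" by auto
    have "b (m - 1) \<in> {1..n}" if "m \<in> {1..d+1}" "m \<noteq> 1" for m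
      using that by (intro PiE_mem[OF b]) auto
    with a show ?case unfolding p by (simp add: PiE_iff)
  next
    case (3 i)
    then show ?case by (auto simp: PiE_iff extensional_def fun_eq_iff)
  next
    case (5 p)
    then obtain a b where p: "p = (a, b)" and b: "b \<in> {1..d} \<rightarrow>\<^sub>E {1..n}" by auto
    have "(\<lambda>j\<in>{1..d}. b j) = b"
      using b by (rule PiE_restrict)
    moreover have "(\<lambda>j\<in>{1..d}. (\<lambda>m\<in>{1..d+1}. if m = 1 then a else b (m - 1)) (j + 1)) = (\<lambda>j\<in>{1..d}. b j)"
      by (auto simp: fun_eq_iff)
    ultimately show ?case by (simp add: p)
  qed (auto simp: PiE_iff)
  finally show ?thesis by simp
qed

text \<open>The choices of \<open>i\<close> run through the atoms of the product of the empirical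
  marginals. Restriction to \<open>{1..d}\<close> makes the result a point of the extensional
  product space.\<close>

definition marginal_mix :: "nat \<Rightarrow> (nat \<Rightarrow> nat \<Rightarrow> 'a) \<Rightarrow> (nat \<Rightarrow> nat) \<Rightarrow> nat \<Rightarrow> 'a" where
  "marginal_mix d D i = (\<lambda>j\<in>{1..d}. D (i j) j)"

text \<open>The right-hand side is the expression \<open>Q\<close> of
  \<open>empirical_distance\<close> with weight \<open>1 / n\<close> on the sample points and
  \<open>1 / n ^ d\<close> on the mixed points.\<close>

lemma dHSIC_hat_eq:
  fixes D :: "nat \<Rightarrow> nat \<Rightarrow> 'a" and d :: nat
  defines "z \<equiv> \<lambda>i. restrict (D i) {1..d}" and "w \<equiv> marginal_mix d D"
  shows "dHSIC_hat d k n D =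
    (1 / real n)\<^sup>2 * (\<Sum>a\<in>{1..n}. \<Sum>b\<in>{1..n}. tensor_kernel d k (z a) (z b))
    + (1 / real n ^ d)\<^sup>2 * (\<Sum>a\<in>index_tuples d n. \<Sum>b\<in>index_tuples d n. tensor_kernel d k (w a) (w b))
    - 2 * (1 / real n) * (1 / real n ^ d) *
      (\<Sum>a\<in>{1..n}. \<Sum>b\<in>index_tuples d n. tensor_kernel d k (z a) (w b))"
proof -
  have 1: "(\<Sum>i\<in>index_tuples 2 n. \<Prod>j = 1..d. k j (D (i 1) j) (D (i 2) j)) =
      (\<Sum>a\<in>{1..n}. \<Sum>b\<in>{1..n}. tensor_kernel d k (z a) (z b))"
    by (subst sum_index_tuples_2[symmetric])
      (auto simp: tensor_kernel_def z_def intro!: sum.cong prod.cong)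
  have 2: "(\<Sum>i\<in>index_tuples (2 * d) n. \<Prod>j = 1..d. k j (D (i (2 * j - 1)) j) (D (i (2 * j)) j)) =
      (\<Sum>a\<in>index_tuples d n. \<Sum>b\<in>index_tuples d n. tensor_kernel d k (w a) (w b))"
    by (subst sum_index_tuples_double[symmetric])
      (auto simp: tensor_kernel_def w_def marginal_mix_def intro!: sum.cong prod.cong)
  have 3: "(\<Sum>i\<in>index_tuples (d + 1) n. \<Prod>j = 1..d. k j (D (i 1) j) (D (i (j + 1)) j)) =
      (\<Sum>a\<in>{1..n}. \<Sum>b\<in>index_tuples d n. tensor_kernel d k (z a) (w b))"
    by (subst sum_index_tuples_Suc[symmetric])
      (auto simp: tensor_kernel_def z_def w_def marginal_mix_def intro!: sum.cong prod.cong)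
  show ?thesis
    unfolding dHSIC_hat_def 1 2 3
    by (simp add: power_divide power_mult[symmetric] mult.commute)
qed

text \<open>By distributivity, summing a tensor product kernel over the product of the empirical
  marginals factorises, leaving only averages over single components.\<close>

lemma sum_tensor_marginal_mix:
  "(\<Sum>b\<in>index_tuples d n. tensor_kernel d k x (marginal_mix d D b)) = (\<Prod>j\<in>{1..d}. \<Sum>i\<in>{1..n}. k j (x j) (D i j))"
proof -
  have "(\<Prod>j\<in>{1..d}. \<Sum>i\<in>{1..n}. k j (x j) (D i j)) = (\<Sum>b\<in>index_tuples d n. \<Prod>j\<in>{1..d}. k j (x j) (D (b j) j))"
    unfolding index_tuples_def by (subst prod_sum_PiE) auto
  then show ?thesis by (simp add: tensor_kernel_def marginal_mix_def)
qed

text \<open>Both parts are \<open>empirical_distance\<close> for the sample and its mixed points: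
  the estimator is a squared norm, and it controls the value at \<open>x\<close> of the embedding
  difference.\<close>

lemma
  assumes rk: "is_rkhs (PiE {1..d} S) (tensor_kernel d k) H ip"
    and D: "\<And>i j. i \<in> {1..n} \<Longrightarrow> j \<in> {1..d} \<Longrightarrow> D i j \<in> S j"
  shows dHSIC_hat_nonneg: "0 \<le> dHSIC_hat d k n D"
    and dHSIC_hat_lower: "x \<in> PiE {1..d} S \<Longrightarrow>
      ((\<Sum>i\<in>{1..n}. tensor_kernel d k x (D i)) / real n -
        (\<Prod>j\<in>{1..d}. (\<Sum>i\<in>{1..n}. k j (x j) (D i j)) / real n))\<^sup>2
      \<le> dHSIC_hat d k n D * tensor_kernel d k x x"
proof -
  interpret rkhs "PiE {1..d} S" "tensor_kernel d k" H ip by standard (rule rk)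
  have z: "\<And>i. i \<in> {1..n} \<Longrightarrow> restrict (D i) {1..d} \<in> PiE {1..d} S" using D by auto
  have w: "\<And>i. i \<in> index_tuples d n \<Longrightarrow> marginal_mix d D i \<in> PiE {1..d} S"
    using D by (auto simp: marginal_mix_def index_tuples_def PiE_iff)
  have fin: "finite (index_tuples d n)" by (simp add: index_tuples_def finite_PiE)
  note emp = empirical_distance[where I = "{1..n}" and z = "\<lambda>i. restrict (D i) {1..d}" and J = "index_tuples d n"
      and w = "marginal_mix d D" and a = "1 / real n" and b = "1 / real n ^ d", OF finite_atLeastAtMost z fin w, folded dHSIC_hat_eq]
  show "0 \<le> dHSIC_hat d k n D" using emp(1) by simp
  assume x: "x \<in> PiE {1..d} S"
  have "(\<Sum>i\<in>{1..n}. tensor_kernel d k x (restrict (D i) {1..d})) = (\<Sum>i\<in>{1..n}. tensor_kernel d k x (D i))"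
    by (intro sum.cong tensor_kernel_cong) auto
  then show "((\<Sum>i\<in>{1..n}. tensor_kernel d k x (D i)) / real n -
        (\<Prod>j\<in>{1..d}. (\<Sum>i\<in>{1..n}. k j (x j) (D i j)) / real n))\<^sup>2
      \<le> dHSIC_hat d k n D * tensor_kernel d k x x"
    using emp(2)[OF _ _ x] unfolding sum_tensor_marginal_mix by (simp add: prod_dividef)
qed

section \<open>Counting collisions of permuted indices\<close>

lemma permutation_vectors_finite: "finite (permutation_vectors d n)"
  unfolding permutation_vectors_def by (intro finite_PiE) (auto intro: finite_permutations)

lemma card_permutation_vectors: "card (permutation_vectors d n) = fact n ^ (d - 1)"
  unfolding permutation_vectors_def by (subst card_PiE) (auto simp: card_permutations)

lemma card_index_tuples: "card (index_tuples q n) = n ^ q"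
  unfolding index_tuples_def by (subst card_PiE) auto

lemma index_tuples_finite: "finite (index_tuples q n)"
  unfolding index_tuples_def by (intro finite_PiE) auto

text \<open>A tuple with \<open>i a = i b\<close> is determined by its slots other than
  \<open>a\<close>, so erasing slot \<open>a\<close> is injective on the collisions.\<close>

lemma card_index_tuples_collision:
  assumes "a \<in> {1..q}" "b \<in> {1..q}" "a \<noteq> b"
  shows "n * card {i \<in> index_tuples q n. i a = i b} \<le> n ^ q"
proof -
  let ?A = "{i \<in> index_tuples q n. i a = i b}"
  have "card ?A \<le> card (({1..q} - {a}) \<rightarrow>\<^sub>E {1..n})"
  proof (rule card_inj_on_le)
    show "inj_on (\<lambda>i. restrict i ({1..q} - {a})) ?A"
    proof (rule inj_onI)
      fix x y assume x: "x \<in> ?A" and y: "y \<in> ?A"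
        and eq: "restrict x ({1..q} - {a}) = restrict y ({1..q} - {a})"
      have ne: "x m = y m" if "m \<in> {1..q} - {a}" for m
        using fun_cong[OF eq, of m] that by simp
      then have "x a = y a" using x y assms ne[of b] by auto
      then have "x m = y m" if "m \<in> {1..q}" for m using ne that by blast
      then show "x = y" using x y by (intro PiE_ext[of _ "{1..q}"]) (auto simp: index_tuples_def)
    qed
    show "(\<lambda>i. restrict i ({1..q} - {a})) ` ?A \<subseteq> ({1..q} - {a}) \<rightarrow>\<^sub>E {1..n}"
    proof (rule image_subsetI)
      fix i assume "i \<in> ?A"
      then have "i m \<in> {1..n}" if "m \<in> {1..q}" for m
        using PiE_mem[OF _ that] by (auto simp: index_tuples_def simp del: atLeastAtMost_iff)
      then show "restrict i ({1..q} - {a}) \<in> ({1..q} - {a}) \<rightarrow>\<^sub>E {1..n}"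
        by (simp add: restrict_PiE_iff del: atLeastAtMost_iff)
    qed
  qed (auto intro: finite_PiE)
  also have "\<dots> = n ^ (q - 1)"
    using assms by (simp add: card_PiE card_Diff_singleton)
  finally have "n * card ?A \<le> n * n ^ (q - 1)" by simp
  also have "\<dots> = n ^ q" using assms by (cases q) auto
  finally show ?thesis .
qed

text \<open>The target \<open>R\<close> may depend on the other permutations: composing \<open>\<psi> l\<close> with the transposition
  of \<open>R \<psi>\<close> and \<open>r\<close> turns the event \<open>\<psi> l s = R \<psi>\<close> into \<open>\<psi> l s = r\<close>.\<close>

lemma card_permutation_vectors_collision:
  assumes l: "l \<in> {1..d - 1}" and s: "s \<in> {1..n}"
    and R: "\<And>\<psi>. \<psi> \<in> permutation_vectors d n \<Longrightarrow> R \<psi> \<in> {1..n}"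
    and indep: "\<And>\<psi> \<sigma>. R (\<psi>(l := \<sigma>)) = R \<psi>"
  shows "n * card {\<psi> \<in> permutation_vectors d n. \<psi> l s = R \<psi>} = fact n ^ (d - 1)"
proof -
  let ?P = "permutation_vectors d n"
  have card_eq: "card {\<psi> \<in> ?P. \<psi> l s = R \<psi>} = card {\<psi> \<in> ?P. \<psi> l s = r}" if r: "r \<in> {1..n}" for r
  proof -
    define F where "F \<psi> = \<psi>(l := Transposition.transpose (R \<psi>) r \<circ> \<psi> l)" for \<psi>
    have FP: "F \<psi> \<in> ?P" if "\<psi> \<in> ?P" for \<psi>
    proof -
      have "\<psi> l permutes {1..n}" using that l by (auto simp: permutation_vectors_def)
      then have "Transposition.transpose (R \<psi>) r \<circ> \<psi> l permutes {1..n}"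
        using R[OF that] r by (intro permutes_compose permutes_swap_id)
      then show ?thesis using that l
        unfolding F_def permutation_vectors_def by (auto simp: PiE_iff extensional_def)
    qed
    \<comment> \<open>\<open>F\<close> changes only component \<open>l\<close>, on which
      \<open>R\<close> does not depend; applying \<open>F\<close> twice therefore composes the same
      transposition twice, and \<open>F\<close> is an involution.\<close>
    have RF: "R (F \<psi>) = R \<psi>" for \<psi> unfolding F_def by (rule indep)
    have FF: "F (F \<psi>) = \<psi>" for \<psi>
      unfolding F_def[of "F \<psi>"] RF by (simp add: F_def fun_eq_iff)
    have "bij_betw F {\<psi> \<in> ?P. \<psi> l s = R \<psi>} {\<psi> \<in> ?P. \<psi> l s = r}"
    proof (rule bij_betwI[of _ _ _ F])
      show "F \<in> {\<psi> \<in> ?P. \<psi> l s = R \<psi>} \<rightarrow> {\<psi> \<in> ?P. \<psi> l s = r}"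
        using FP by (auto simp: F_def)
      have "F \<psi> l s = R (F \<psi>)" if "\<psi> l s = r" for \<psi>
        using that unfolding RF by (simp add: F_def)
      then show "F \<in> {\<psi> \<in> ?P. \<psi> l s = r} \<rightarrow> {\<psi> \<in> ?P. \<psi> l s = R \<psi>}"
        using FP by auto
    qed (use FF in auto)
    then show ?thesis by (rule bij_betw_same_card)
  qed
  \<comment> \<open>All \<open>n\<close> values of \<open>r\<close> give the same count, and the
    events \<open>\<psi> l s = r\<close> partition the permutation vectors.\<close>
  have "n * card {\<psi> \<in> ?P. \<psi> l s = R \<psi>} = (\<Sum>r\<in>{1..n}. card {\<psi> \<in> ?P. \<psi> l s = r})"
  proof -
    have "(\<Sum>r\<in>{1..n}. card {\<psi> \<in> ?P. \<psi> l s = r}) = (\<Sum>r\<in>{1..n}. card {\<psi> \<in> ?P. \<psi> l s = R \<psi>})"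
      by (intro sum.cong refl) (use card_eq in \<open>simp del: atLeastAtMost_iff\<close>)
    then show ?thesis by simp
  qed
  also have "\<dots> = card (\<Union>r\<in>{1..n}. {\<psi> \<in> ?P. \<psi> l s = r})"
    by (subst card_UN_disjoint) (auto simp: permutation_vectors_finite)
  also have "(\<Union>r\<in>{1..n}. {\<psi> \<in> ?P. \<psi> l s = r}) = ?P"
  proof -
    have "\<psi> l s \<in> {1..n}" if "\<psi> \<in> ?P" for \<psi>
    proof -
      have "\<psi> l permutes {1..n}" using that l by (auto simp: permutation_vectors_def)
      then show ?thesis using s permutes_in_image by metis
    qed
    then show ?thesis by blast
  qed
  finally show ?thesis by (simp add: card_permutation_vectors)
qed

text \<open>Slot \<open>2 * j - 1\<close> (resp. \<open>2 * j\<close>) of this tuple is the data index at which the first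
  (resp. second) argument of \<open>k j\<close> is evaluated on permuted data; \<open>u\<close> and \<open>v\<close> select the summation
  indices used by the three terms of the estimator.\<close>

definition perm_index :: "(nat \<Rightarrow> nat \<Rightarrow> nat) \<Rightarrow> nat \<Rightarrow> nat \<Rightarrow> nat" where
  "perm_index \<psi> j m = (if j = 1 then m else \<psi> (j - 1) m)"

definition slot_tuple ::
  "nat \<Rightarrow> (nat \<Rightarrow> nat) \<Rightarrow> (nat \<Rightarrow> nat) \<Rightarrow> (nat \<Rightarrow> nat \<Rightarrow> nat) \<Rightarrow> (nat \<Rightarrow> nat) \<Rightarrow> nat \<Rightarrow> nat" where
  "slot_tuple d u v \<psi> i = (\<lambda>m\<in>{1..2*d}. let j = (m + 1) div 2 in
     perm_index \<psi> j (i (if odd m then u j else v j)))"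

lemma permuted_data_eq: "permuted_data \<psi> D i j = D (perm_index \<psi> j i) j"
  by (simp add: permuted_data_def perm_index_def)

lemma perm_index_permutes:
  assumes "\<psi> \<in> permutation_vectors d n" "j \<in> {1..d}"
  shows "perm_index \<psi> j permutes {1..n}"
proof (cases "j = 1")
  case True
  then have "perm_index \<psi> j = id" by (auto simp: perm_index_def)
  then show ?thesis by (simp only: permutes_id)
next
  case False
  then have "perm_index \<psi> j = \<psi> (j - 1)" by (auto simp: perm_index_def)
  moreover have "\<psi> (j - 1) permutes {1..n}"
  proof -
    have "j - 1 \<in> {1..d - 1}" using assms(2) False by auto
    then show ?thesis using assms(1) unfolding permutation_vectors_def by blast
  qed
  ultimately show ?thesis by simp
qed

lemma perm_index_in:
  assumes "\<psi> \<in> permutation_vectors d n" "j \<in> {1..d}" "m \<in> {1..n}"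
  shows "perm_index \<psi> j m \<in> {1..n}"
  using permutes_in_image[OF perm_index_permutes[OF assms(1,2)]] assms(3) by blast

text \<open>For fixed \<open>i\<close> the target \<open>perm_index \<psi> j' (i y)\<close> does not
  involve component \<open>j - 1\<close> of \<open>\<psi>\<close>, so the count over permutation
  vectors applies and is summed over \<open>i\<close>. Component \<open>1\<close> is excluded for
  \<open>j\<close> because it carries no permutation.\<close>

lemma perm_index_collision:
  assumes j: "j \<in> {1..d}" and j': "j' \<in> {1..d}" and ne: "j \<noteq> j'" and j1: "j \<noteq> 1"
    and x: "x \<in> {1..Q}" and y: "y \<in> {1..Q}"
  shows "n * card {(\<psi>, i) \<in> permutation_vectors d n \<times> index_tuples Q n.
      perm_index \<psi> j (i x) = perm_index \<psi> j' (i y)} = fact n ^ (d - 1) * n ^ Q"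
    (is "n * card ?A = _")
proof -
  let ?P = "permutation_vectors d n" and ?I = "index_tuples Q n"
  define B where "B i = {\<psi> \<in> ?P. \<psi> (j - 1) (i x) = perm_index \<psi> j' (i y)}" for i :: "nat \<Rightarrow> nat"
  have "bij_betw (\<lambda>(i, \<psi>). (\<psi>, i)) (SIGMA i:?I. B i) ?A"
    using j1 by (intro bij_betwI[of _ _ _ "\<lambda>(i, \<psi>). (\<psi>, i)"]) (auto simp: B_def perm_index_def[of _ j])
  then have "card ?A = card (SIGMA i:?I. B i)" by (simp add: bij_betw_same_card)
  also have "\<dots> = (\<Sum>i\<in>?I. card (B i))"
    by (rule card_SigmaI) (auto simp: index_tuples_finite B_def permutation_vectors_finite)
  finally have "n * card ?A = (\<Sum>i\<in>?I. n * card (B i))"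
    by (simp add: sum_distrib_left)
  also have "\<dots> = (\<Sum>i\<in>?I. fact n ^ (d - 1))"
  proof (rule sum.cong[OF refl])
    fix i assume "i \<in> ?I"
    then have i: "i x \<in> {1..n}" "i y \<in> {1..n}" using x y unfolding index_tuples_def by blast+
    show "n * card (B i) = fact n ^ (d - 1)"
      unfolding B_def
    proof (rule card_permutation_vectors_collision)
      show "j - 1 \<in> {1..d - 1}" using j j1 by auto
      show "perm_index (\<psi>(j - 1 := \<sigma>)) j' (i y) = perm_index \<psi> j' (i y)" for \<psi> \<sigma>
        using ne j j' by (auto simp: perm_index_def)
    qed (use i perm_index_in[OF _ j'] in auto)
  qed
  finally show ?thesis by (simp add: card_index_tuples)
qed

context
  fixes d n Q :: nat and u v :: "nat \<Rightarrow> nat"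
  assumes uv: "\<And>j. j \<in> {1..d} \<Longrightarrow> u j \<in> {1..Q} \<and> v j \<in> {1..Q} \<and> u j \<noteq> v j"
begin

lemma slot_tuple_in:
  assumes "\<psi> \<in> permutation_vectors d n" "i \<in> index_tuples Q n"
  shows "slot_tuple d u v \<psi> i \<in> index_tuples (2 * d) n"
proof -
  have "perm_index \<psi> j (i (if odd m then u j else v j)) \<in> {1..n}"
    if "m \<in> {1..2*d}" "j = (m + 1) div 2" for m j
  proof (rule perm_index_in[OF assms(1)])
    show j: "j \<in> {1..d}" using that by auto
    show "i (if odd m then u j else v j) \<in> {1..n}"
      using uv[OF j] assms(2) PiE_mem[of i "{1..Q}" "\<lambda>_. {1..n}"] unfolding index_tuples_def by presburger
  qed
  then show ?thesis unfolding slot_tuple_def index_tuples_def Let_def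
    by (auto simp del: atLeastAtMost_iff)
qed

text \<open>Within one component the permutation is injective, so a collision is one of the
  summation indices, where \<open>u j \<noteq> v j\<close> makes it rare. Between two components it
  is rare by the randomness of a permutation.\<close>

lemma slot_tuple_collision:
  assumes a: "a \<in> {1..2*d}" and b: "b \<in> {1..2*d}" and ab: "a \<noteq> b"
  shows "n * card {(\<psi>, i) \<in> permutation_vectors d n \<times> index_tuples Q n.
      slot_tuple d u v \<psi> i a = slot_tuple d u v \<psi> i b} \<le> fact n ^ (d - 1) * n ^ Q"
    (is "n * card ?A \<le> _")
proof -
  define s where "s m = (if odd m then u ((m + 1) div 2) else v ((m + 1) div 2))" for m
  have slot: "slot_tuple d u v \<psi> i m = perm_index \<psi> ((m + 1) div 2) (i (s m))" if "m \<in> {1..2*d}" for \<psi> i m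
    using that by (simp add: slot_tuple_def s_def Let_def)
  have comp: "(m + 1) div 2 \<in> {1..d}" if "m \<in> {1..2*d}" for m using that by auto
  have s_in: "s m \<in> {1..Q}" if "m \<in> {1..2*d}" for m
    using uv[OF comp[OF that]] by (auto simp: s_def)
  let ?P = "permutation_vectors d n" and ?I = "index_tuples Q n"
  have I_in: "i (s m) \<in> {1..n}" if "m \<in> {1..2*d}" "i \<in> ?I" for i m
    using that s_in unfolding index_tuples_def by blast
  show ?thesis
  proof (cases "(a + 1) div 2 = (b + 1) div 2")
    case True
    \<comment> \<open>Distinct slots of the same component have opposite parity, so one reads
      \<open>u\<close> and the other \<open>v\<close>.\<close>
    have odd_ne: "odd a \<noteq> odd b" using True ab by presburger
    have ne: "s a \<noteq> s b" using uv[OF comp[OF a]] True odd_ne by (auto simp: s_def)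
    have "?A \<subseteq> ?P \<times> {i \<in> ?I. i (s a) = i (s b)}"
    proof
      fix p assume "p \<in> ?A"
      then obtain \<psi> i where p: "p = (\<psi>, i)" and \<psi>: "\<psi> \<in> ?P" and i: "i \<in> ?I"
        and eq: "slot_tuple d u v \<psi> i a = slot_tuple d u v \<psi> i b" by blast
      have "inj (perm_index \<psi> ((a + 1) div 2))"
        using perm_index_permutes[OF \<psi> comp[OF a]] by (rule permutes_inj)
      moreover have "perm_index \<psi> ((a + 1) div 2) (i (s a)) = perm_index \<psi> ((a + 1) div 2) (i (s b))"
        using eq unfolding slot[OF a] slot[OF b] True by simp
      ultimately have "i (s a) = i (s b)" by (metis injD)
      then show "p \<in> ?P \<times> {i \<in> ?I. i (s a) = i (s b)}" using i \<psi> p by simp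
    qed
    then have "card ?A \<le> card (?P \<times> {i \<in> ?I. i (s a) = i (s b)})"
      by (intro card_mono finite_cartesian_product permutation_vectors_finite)
        (simp_all add: index_tuples_finite)
    also have "\<dots> = fact n ^ (d - 1) * card {i \<in> ?I. i (s a) = i (s b)}"
      by (simp add: card_cartesian_product card_permutation_vectors)
    finally have "n * card ?A \<le> fact n ^ (d - 1) * (n * card {i \<in> ?I. i (s a) = i (s b)})"
      by (simp add: algebra_simps)
    also have "\<dots> \<le> fact n ^ (d - 1) * n ^ Q"
      using card_index_tuples_collision[OF s_in[OF a] s_in[OF b] ne] by simp
    finally show ?thesis .
  next
    case False
    let ?ja = "(a + 1) div 2" and ?jb = "(b + 1) div 2"
    have A: "?A = {(\<psi>, i) \<in> ?P \<times> ?I. perm_index \<psi> ?ja (i (s a)) = perm_index \<psi> ?jb (i (s b))}"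
      by (simp only: slot[OF a] slot[OF b])
    also have "n * card \<dots> = fact n ^ (d - 1) * n ^ Q"
    \<comment> \<open>The components differ, so at least one of them is permuted; that one supplies
      the random side of the collision.\<close>
    proof (cases "?ja = 1")
      case True
      have "{(\<psi>, i) \<in> ?P \<times> ?I. perm_index \<psi> ?ja (i (s a)) = perm_index \<psi> ?jb (i (s b))} =
        {(\<psi>, i) \<in> ?P \<times> ?I. perm_index \<psi> ?jb (i (s b)) = perm_index \<psi> ?ja (i (s a))}" by auto
      then show ?thesis
        using perm_index_collision[OF comp[OF b] comp[OF a] _ _ s_in[OF b] s_in[OF a]] True False by simp
    next
      case ja: False
      then show ?thesis
        using perm_index_collision[OF comp[OF a] comp[OF b] _ _ s_in[OF a] s_in[OF b]] False by simp
    qed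
    finally show ?thesis by simp
  qed
qed

text \<open>Union bound over the at most \<open>(2 * d)\<^sup>2\<close> ordered pairs of distinct
  slots.\<close>

lemma slot_tuple_not_inj:
  "n * card {(\<psi>, i) \<in> permutation_vectors d n \<times> index_tuples Q n.
      \<not> inj_on (slot_tuple d u v \<psi> i) {1..2*d}} \<le> (2 * d)\<^sup>2 * (fact n ^ (d - 1) * n ^ Q)"
    (is "n * card ?N \<le> _")
proof -
  define A where "A p = {(\<psi>, i) \<in> permutation_vectors d n \<times> index_tuples Q n.
      slot_tuple d u v \<psi> i (fst p) = slot_tuple d u v \<psi> i (snd p)}" for p
  define Z where "Z = {p \<in> {1..2*d} \<times> {1..2*d}. fst p \<noteq> snd p}"
  have finZ: "finite Z" unfolding Z_def by simp
  have fin: "finite (A p)" for p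
    unfolding A_def
    by (rule finite_subset[of _ "permutation_vectors d n \<times> index_tuples Q n"])
      (auto simp: permutation_vectors_finite index_tuples_finite)
  have "?N \<subseteq> (\<Union>p\<in>Z. A p)"
    unfolding inj_on_def A_def Z_def by fastforce
  then have "card ?N \<le> card (\<Union>p\<in>Z. A p)"
    using fin finZ by (intro card_mono) auto
  also have "\<dots> \<le> (\<Sum>p\<in>Z. card (A p))" by (rule card_UN_le[OF finZ])
  finally have "n * card ?N \<le> (\<Sum>p\<in>Z. n * card (A p))"
    by (simp add: sum_distrib_left[symmetric])
  also have "\<dots> \<le> (\<Sum>p\<in>Z. fact n ^ (d - 1) * n ^ Q)"
    unfolding A_def by (intro sum_mono slot_tuple_collision) (auto simp: Z_def)
  also have "\<dots> = card Z * (fact n ^ (d - 1) * n ^ Q)" by simp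
  also have "\<dots> \<le> (2 * d)\<^sup>2 * (fact n ^ (d - 1) * n ^ Q)"
  proof (rule mult_right_mono)
    have "card Z \<le> card ({1..2*d} \<times> {1..2*d})"
      unfolding Z_def by (intro card_mono) auto
    then show "card Z \<le> (2 * d)\<^sup>2" by (simp add: power2_eq_square)
  qed simp
  finally show ?thesis .
qed

end

section \<open>Permutation averages\<close>

text \<open>With suitable tuples \<open>t\<close>, the summands of all three sums of the estimator
  on permuted data take this form, so one moment bound covers them all.\<close>

definition slot_product ::
  "nat \<Rightarrow> (nat \<Rightarrow> 'a \<Rightarrow> 'a \<Rightarrow> real) \<Rightarrow> (nat \<Rightarrow> nat \<Rightarrow> 'a) \<Rightarrow> (nat \<Rightarrow> nat) \<Rightarrow> real" where
  "slot_product d k D t = (\<Prod>j = 1..d. k j (D (t (2 * j - 1)) j) (D (t (2 * j)) j))"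

lemma slot_product_slot_tuple:
  "slot_product d k D (slot_tuple d u v \<psi> i) =
    (\<Prod>j = 1..d. k j (permuted_data \<psi> D (i (u j)) j) (permuted_data \<psi> D (i (v j)) j))"
  unfolding slot_product_def
proof (rule prod.cong[OF refl])
  fix j assume j: "j \<in> {1..d}"
  then have "odd (2 * j - 1)" "(2 * j - 1 + 1) div 2 = j" "(2 * j + 1) div 2 = j"
    "2 * j - 1 \<in> {1..2*d}" "2 * j \<in> {1..2*d}"
    by auto
  then have "slot_tuple d u v \<psi> i (2 * j - 1) = perm_index \<psi> j (i (u j))"
    "slot_tuple d u v \<psi> i (2 * j) = perm_index \<psi> j (i (v j))"
    unfolding slot_tuple_def Let_def by simp_all
  then show "k j (D (slot_tuple d u v \<psi> i (2 * j - 1)) j) (D (slot_tuple d u v \<psi> i (2 * j)) j) =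
      k j (permuted_data \<psi> D (i (u j)) j) (permuted_data \<psi> D (i (v j)) j)"
    by (simp add: permuted_data_eq)
qed

lemma dHSIC_hat_permuted:
  "dHSIC_hat d k n (permuted_data \<psi> D) =
     1 / real n ^ 2 * (\<Sum>i\<in>index_tuples 2 n. slot_product d k D (slot_tuple d (\<lambda>_. 1) (\<lambda>_. 2) \<psi> i))
   + 1 / real n ^ (2 * d) * (\<Sum>i\<in>index_tuples (2 * d) n.
       slot_product d k D (slot_tuple d (\<lambda>j. 2 * j - 1) (\<lambda>j. 2 * j) \<psi> i))
   - 2 / real n ^ (d + 1) * (\<Sum>i\<in>index_tuples (d + 1) n.
       slot_product d k D (slot_tuple d (\<lambda>_. 1) (\<lambda>j. j + 1) \<psi> i))"
  unfolding dHSIC_hat_def slot_product_slot_tuple by simp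

definition perm_avg :: "nat \<Rightarrow> nat \<Rightarrow> ((nat \<Rightarrow> nat \<Rightarrow> nat) \<Rightarrow> real) \<Rightarrow> real" where
  "perm_avg d n g = 1 / fact n ^ (d - 1) * (\<Sum>\<psi>\<in>permutation_vectors d n. g \<psi>)"

text \<open>\<open>E t\<close> stands for the expected slot product at the data indices
  \<open>t\<close>. Tuples with a repeated index make up a fraction of at most
  \<open>(2 * d)\<^sup>2 / n\<close>, and each deviates from \<open>a\<close> by at most
  \<open>2 * C\<close>.\<close>

lemma permutation_average_near:
  fixes E :: "(nat \<Rightarrow> nat) \<Rightarrow> real"
  assumes uv: "\<And>j. j \<in> {1..d} \<Longrightarrow> u j \<in> {1..Q} \<and> v j \<in> {1..Q} \<and> u j \<noteq> v j"
    and n: "n > 0"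
    and bound: "\<And>t. t \<in> index_tuples (2 * d) n \<Longrightarrow> \<bar>E t\<bar> \<le> C"
    and inj: "\<And>t. t \<in> index_tuples (2 * d) n \<Longrightarrow> inj_on t {1..2*d} \<Longrightarrow> E t = a"
    and a: "\<bar>a\<bar> \<le> C"
  shows "\<bar>perm_avg d n (\<lambda>\<psi>. 1 / real n ^ Q * (\<Sum>i\<in>index_tuples Q n. E (slot_tuple d u v \<psi> i))) - a\<bar>
    \<le> 2 * C * (2 * d)\<^sup>2 / n"
proof -
  let ?P = "permutation_vectors d n" and ?I = "index_tuples Q n"
  define N where "N = {(\<psi>, i) \<in> ?P \<times> ?I. \<not> inj_on (slot_tuple d u v \<psi> i) {1..2*d}}"
  define T :: real where "T = fact n ^ (d - 1) * real n ^ Q"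
  have T: "T > 0" using n by (simp add: T_def)
  have finPI: "finite (?P \<times> ?I)" by (simp add: permutation_vectors_finite index_tuples_finite)
  have C: "0 \<le> C" using a by linarith
  have cardPI: "real (card (?P \<times> ?I)) = T"
    by (simp add: T_def card_cartesian_product card_permutation_vectors card_index_tuples)
  have "perm_avg d n (\<lambda>\<psi>. 1 / real n ^ Q * (\<Sum>i\<in>?I. E (slot_tuple d u v \<psi> i))) =
      (\<Sum>(\<psi>, i)\<in>?P \<times> ?I. E (slot_tuple d u v \<psi> i)) / T"
    unfolding perm_avg_def T_def by (simp add: sum_divide_distrib[symmetric] sum.cartesian_product)
  also have "\<dots> - a = (\<Sum>(\<psi>, i)\<in>?P \<times> ?I. E (slot_tuple d u v \<psi> i) - a) / T"
    using T cardPI by (simp add: sum_subtractf case_prod_beta diff_divide_distrib)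
  finally have eq: "\<bar>perm_avg d n (\<lambda>\<psi>. 1 / real n ^ Q * (\<Sum>i\<in>?I. E (slot_tuple d u v \<psi> i))) - a\<bar> =
      \<bar>\<Sum>(\<psi>, i)\<in>?P \<times> ?I. E (slot_tuple d u v \<psi> i) - a\<bar> / T"
    using T by simp
  have "\<bar>\<Sum>(\<psi>, i)\<in>?P \<times> ?I. E (slot_tuple d u v \<psi> i) - a\<bar> \<le> (\<Sum>p\<in>?P \<times> ?I. if p \<in> N then 2 * C else 0)"
  proof (rule order_trans[OF sum_abs sum_mono])
    fix p assume "p \<in> ?P \<times> ?I"
    then obtain \<psi> i where p: "p = (\<psi>, i)" "\<psi> \<in> ?P" "i \<in> ?I" by blast
    have t: "slot_tuple d u v \<psi> i \<in> index_tuples (2 * d) n"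
      by (rule slot_tuple_in[OF uv p(2,3)])
    show "\<bar>case p of (\<psi>, i) \<Rightarrow> E (slot_tuple d u v \<psi> i) - a\<bar> \<le> (if p \<in> N then 2 * C else 0)"
      using bound[OF t] inj[OF t] a p by (auto simp: N_def)
  qed
  also have "\<dots> = (\<Sum>p\<in>N. 2 * C)"
  proof -
    have "(?P \<times> ?I) \<inter> N = N" unfolding N_def by blast
    then show ?thesis using finPI by (simp add: sum.If_cases)
  qed
  also have "\<dots> = 2 * C * card N" by simp
  also have "\<dots> \<le> 2 * C * ((2 * d)\<^sup>2 * T / n)"
  proof (rule mult_left_mono)
    have "n * card N \<le> (2 * d)\<^sup>2 * (fact n ^ (d - 1) * n ^ Q)"
      using slot_tuple_not_inj[OF uv] unfolding N_def .
    then have "real (n * card N) \<le> real ((2 * d)\<^sup>2 * (fact n ^ (d - 1) * n ^ Q))"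
      by (rule of_nat_mono)
    then show "real (card N) \<le> (2 * d)\<^sup>2 * T / n"
      using n by (simp add: T_def field_simps)
  qed (use C in simp)
  finally have "\<bar>\<Sum>(\<psi>, i)\<in>?P \<times> ?I. E (slot_tuple d u v \<psi> i) - a\<bar> / T \<le> 2 * C * ((2 * d)\<^sup>2 * T / n) / T"
    using T by (intro divide_right_mono) auto
  also have "\<dots> = 2 * C * (2 * d)\<^sup>2 / n" using T by simp
  finally show ?thesis unfolding eq .
qed

text \<open>The three averages are all close to the same \<open>a\<close>, which cancels since the
  weights \<open>1\<close>, \<open>1\<close> and \<open>- 2\<close> sum to \<open>0\<close>. The
  absolute weights sum to \<open>4\<close>, whence the factor \<open>8 = 4 * 2\<close>.\<close>

lemma perm_avg_dHSIC_le:
  fixes E :: "(nat \<Rightarrow> nat) \<Rightarrow> real"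
  assumes d: "d \<ge> 1" and n: "n > 0"
    and bound: "\<And>t. t \<in> index_tuples (2 * d) n \<Longrightarrow> \<bar>E t\<bar> \<le> C"
    and inj: "\<And>t. t \<in> index_tuples (2 * d) n \<Longrightarrow> inj_on t {1..2*d} \<Longrightarrow> E t = a"
    and a: "\<bar>a\<bar> \<le> C"
  shows "perm_avg d n (\<lambda>\<psi>. 1 / real n ^ 2 * (\<Sum>i\<in>index_tuples 2 n. E (slot_tuple d (\<lambda>_. 1) (\<lambda>_. 2) \<psi> i))
   + 1 / real n ^ (2 * d) * (\<Sum>i\<in>index_tuples (2 * d) n.
       E (slot_tuple d (\<lambda>j. 2 * j - 1) (\<lambda>j. 2 * j) \<psi> i))
   - 2 / real n ^ (d + 1) * (\<Sum>i\<in>index_tuples (d + 1) n.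
       E (slot_tuple d (\<lambda>_. 1) (\<lambda>j. j + 1) \<psi> i))) \<le> 8 * C * (2 * d)\<^sup>2 / n"
proof -
  define A where "A Q u v \<psi> = 1 / real n ^ Q * (\<Sum>i\<in>index_tuples Q n. E (slot_tuple d u v \<psi> i))"
    for Q u v \<psi>
  have near: "\<bar>perm_avg d n (A Q u v) - a\<bar> \<le> 2 * C * (2 * d)\<^sup>2 / n"
    if "\<And>j. j \<in> {1..d} \<Longrightarrow> u j \<in> {1..Q} \<and> v j \<in> {1..Q} \<and> u j \<noteq> v j" for Q u v
    unfolding A_def by (rule permutation_average_near) (fact that n bound inj a)+
  have 1: "\<bar>perm_avg d n (A 2 (\<lambda>_. 1) (\<lambda>_. 2)) - a\<bar> \<le> 2 * C * (2 * d)\<^sup>2 / n"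
    by (rule near) auto
  have 2: "\<bar>perm_avg d n (A (2 * d) (\<lambda>j. 2 * j - 1) (\<lambda>j. 2 * j)) - a\<bar> \<le> 2 * C * (2 * d)\<^sup>2 / n"
    by (rule near) auto
  have 3: "\<bar>perm_avg d n (A (d + 1) (\<lambda>_. 1) (\<lambda>j. j + 1)) - a\<bar> \<le> 2 * C * (2 * d)\<^sup>2 / n"
    by (rule near) auto
  have "perm_avg d n (\<lambda>\<psi>. A 2 (\<lambda>_. 1) (\<lambda>_. 2) \<psi> + A (2 * d) (\<lambda>j. 2 * j - 1) (\<lambda>j. 2 * j) \<psi>
      - 2 * A (d + 1) (\<lambda>_. 1) (\<lambda>j. j + 1) \<psi>)
    = perm_avg d n (A 2 (\<lambda>_. 1) (\<lambda>_. 2)) + perm_avg d n (A (2 * d) (\<lambda>j. 2 * j - 1) (\<lambda>j. 2 * j))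
      - 2 * perm_avg d n (A (d + 1) (\<lambda>_. 1) (\<lambda>j. j + 1))"
    unfolding perm_avg_def
    by (simp add: sum.distrib sum_subtractf sum_distrib_left[symmetric] right_diff_distrib distrib_left)
  also have "\<dots> \<le> 4 * (2 * C * (2 * d)\<^sup>2 / n)" using 1 2 3 by linarith
  finally show ?thesis unfolding A_def by simp
qed

text \<open>Markov's inequality for a uniformly drawn \<open>\<psi>\<close>, with the data held
  fixed.\<close>

lemma perm_p_value_le:
  assumes nonneg: "\<And>\<psi>. \<psi> \<in> permutation_vectors d n \<Longrightarrow> 0 \<le> dHSIC_hat d k n (permuted_data \<psi> D)"
    and \<delta>: "0 < \<delta>" "\<delta> \<le> dHSIC_hat d k n D"
  shows "perm_p_value d k n D \<le> perm_avg d n (\<lambda>\<psi>. dHSIC_hat d k n (permuted_data \<psi> D)) / \<delta>"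
proof -
  let ?P = "permutation_vectors d n" and ?h = "\<lambda>\<psi>. dHSIC_hat d k n (permuted_data \<psi> D)"
  let ?A = "{\<psi> \<in> ?P. ?h \<psi> \<ge> dHSIC_hat d k n D}"
  have "\<delta> * card ?A = (\<Sum>\<psi>\<in>?A. \<delta>)" by simp
  also have "\<dots> \<le> (\<Sum>\<psi>\<in>?A. ?h \<psi>)" using \<delta> by (intro sum_mono) auto
  also have "\<dots> \<le> (\<Sum>\<psi>\<in>?P. ?h \<psi>)"
    using nonneg by (intro sum_mono2) (auto simp: permutation_vectors_finite)
  finally have "real (card ?A) \<le> (\<Sum>\<psi>\<in>?P. ?h \<psi>) / \<delta>" using \<delta> by (simp add: field_simps)
  then have "1 / fact n ^ (d - 1) * real (card ?A) \<le> 1 / fact n ^ (d - 1) * ((\<Sum>\<psi>\<in>?P. ?h \<psi>) / \<delta>)"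
    by (intro mult_left_mono) auto
  then show ?thesis by (simp add: perm_p_value_def perm_avg_def)
qed

section \<open>Borel measures and \<open>\<sigma>\<close>-compact sets\<close>

lemma space_borel_of_topology [simp]: "space (borel_of_topology T) = topspace T"
  unfolding borel_of_topology_def by (rule space_measure_of) (auto dest: openin_subset)

lemma sets_borel_of_topology: "sets (borel_of_topology T) = sigma_sets (topspace T) {U. openin T U}"
  unfolding borel_of_topology_def by (rule sets_measure_of) (auto dest: openin_subset)

lemma openin_in_borel: "openin T U \<Longrightarrow> U \<in> sets (borel_of_topology T)"
  unfolding sets_borel_of_topology by (rule sigma_sets.Basic) simp

lemma closedin_in_borel: "closedin T U \<Longrightarrow> U \<in> sets (borel_of_topology T)"
proof -
  assume U: "closedin T U"
  then have "topspace T - (topspace T - U) \<in> sets (borel_of_topology T)"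
    using openin_in_borel[of T "topspace T - U"] sets.compl_sets[of "topspace T - U" "borel_of_topology T"]
    by (simp add: closedin_def)
  moreover have "topspace T - (topspace T - U) = U" using closedin_subset[OF U] by blast
  ultimately show ?thesis by simp
qed

lemma continuous_map_borel_measurable:
  assumes "continuous_map T euclideanreal f"
  shows "f \<in> borel_measurable (borel_of_topology T)"
proof (rule borel_measurableI)
  fix U :: "real set" assume "open U"
  then have "openin T {x \<in> topspace T. f x \<in> U}"
    using assms by (auto simp: continuous_map_def)
  moreover have "{x \<in> topspace T. f x \<in> U} = f -` U \<inter> space (borel_of_topology T)" by auto
  ultimately show "f -` U \<inter> space (borel_of_topology T) \<in> sets (borel_of_topology T)"
    by (metis openin_in_borel)
qed

definition sigma_compactin :: "'x topology \<Rightarrow> 'x set \<Rightarrow> bool" where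
  "sigma_compactin T K \<longleftrightarrow> (\<exists>L::nat \<Rightarrow> 'x set. (\<forall>m. compactin T (L m)) \<and> K = (\<Union>m. L m))"

lemma sigma_compactin_UN:
  assumes "\<And>n::nat. sigma_compactin T (K n)"
  shows "sigma_compactin T (\<Union>n. K n)"
proof -
  obtain L where L: "\<And>n m::nat. compactin T (L n m)" "\<And>n. K n = (\<Union>m. L n m)"
    using assms unfolding sigma_compactin_def by metis
  have "(\<Union>n. K n) = (\<Union>p. case prod_decode p of (n, m) \<Rightarrow> L n m)"
  proof safe
    fix x n assume "x \<in> K n"
    then obtain m where "x \<in> L n m" using L(2) by blast
    then show "x \<in> (\<Union>p. case prod_decode p of (n, m) \<Rightarrow> L n m)"
      by (intro UN_I[of "prod_encode (n, m)"]) auto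
  qed (use L(2) in \<open>auto split: prod.splits\<close>)
  then show ?thesis unfolding sigma_compactin_def using L(1)
    by (intro exI[of _ "\<lambda>p. case prod_decode p of (n, m) \<Rightarrow> L n m"]) (auto split: prod.splits)
qed

lemma sigma_compactin_Un:
  assumes "sigma_compactin T K" "sigma_compactin T L"
  shows "sigma_compactin T (K \<union> L)"
proof -
  have "K \<union> L = (\<Union>n::nat. if n = 0 then K else L)" by (auto split: if_splits)
  then show ?thesis using sigma_compactin_UN[of T "\<lambda>n. if n = 0 then K else L"] assms by simp
qed

lemma sigma_compactin_borel:
  assumes "Hausdorff_space T" "sigma_compactin T K"
  shows "K \<in> sets (borel_of_topology T)"
proof -
  obtain L where L: "\<And>m::nat. compactin T (L m)" "K = (\<Union>m. L m)"
    using assms(2) unfolding sigma_compactin_def by blast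
  have "L m \<in> sets (borel_of_topology T)" for m
    by (rule closedin_in_borel[OF compactin_imp_closedin[OF assms(1) L(1)]])
  then show ?thesis unfolding L(2) by (intro sets.countable_UN) auto
qed

text \<open>Continuity bounds \<open>f\<close> on the compact set where
  \<open>1 \<le> \<bar>f x\<bar>\<close>, and elsewhere \<open>1\<close> is a bound; the level
  \<open>1\<close> is arbitrary.\<close>

lemma C0_space_bounded:
  assumes "f \<in> C0_space T"
  obtains b where "\<And>x. \<bar>f x\<bar> \<le> b"
proof -
  let ?L = "{x \<in> topspace T. 1 \<le> \<bar>f x\<bar>}"
  have L: "compactin T ?L" using assms by (auto simp: C0_space_def)
  have "compactin euclideanreal (f ` ?L)"
    using assms L by (intro image_compactin) (auto simp: C0_space_def)
  then have "bounded (f ` ?L)" by (simp add: compact_imp_bounded)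
  then obtain b where "\<forall>x\<in>f ` ?L. norm x \<le> b" unfolding bounded_iff by blast
  then have b: "\<bar>f x\<bar> \<le> b" if "x \<in> topspace T" "1 \<le> \<bar>f x\<bar>" for x
    using that by auto
  have out: "f x = 0" if "x \<notin> topspace T" for x
    using assms that by (auto simp: C0_space_def)
  show thesis
  proof (rule that[of "max b 1"])
    fix x
    show "\<bar>f x\<bar> \<le> max b 1"
      using b[of x] out[of x] by (cases "x \<in> topspace T"; cases "1 \<le> \<bar>f x\<bar>") auto
  qed
qed

text \<open>The nonzero set is the countable union of the compact level sets at
  \<open>1 / (m + 1)\<close>. Hence a measure that charges no \<sigma>-compact set annihilates these
  functions.\<close>

lemma C0_space_support:
  assumes "f \<in> C0_space T"
  shows "sigma_compactin T {x. f x \<noteq> 0}"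
proof -
  have "compactin T {x \<in> topspace T. 1 / real (Suc m) \<le> \<bar>f x\<bar>}" for m
    using assms by (auto simp: C0_space_def)
  moreover have "{x. f x \<noteq> 0} = (\<Union>m. {x \<in> topspace T. 1 / real (Suc m) \<le> \<bar>f x\<bar>})"
  proof safe
    fix x assume x: "f x \<noteq> 0"
    then have S: "x \<in> topspace T" using assms by (auto simp: C0_space_def)
    obtain m where "1 / real (Suc m) < \<bar>f x\<bar>"
      using x reals_Archimedean[of "\<bar>f x\<bar>"] by (auto simp: inverse_eq_divide)
    then show "x \<in> (\<Union>m. {x \<in> topspace T. 1 / real (Suc m) \<le> \<bar>f x\<bar>})" using S
      by (auto intro!: exI[of _ m])
  qed auto
  ultimately show ?thesis unfolding sigma_compactin_def
    by (intro exI[of _ "\<lambda>m. {x \<in> topspace T. 1 / real (Suc m) \<le> \<bar>f x\<bar>}"]) simp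
qed

text \<open>A measure not concentrated on a \<open>\<sigma>\<close>-compact set, conditioned on the complement of a
  \<open>\<sigma>\<close>-compact set of maximal mass, gives the measure \<open>Q\<close> of the second alternative.\<close>

lemma sigma_compact_dichotomy:
  assumes P: "prob_space P" and sets: "sets P = sets (borel_of_topology T)" and T: "Hausdorff_space T"
  obtains K where "sigma_compactin T K" "measure P K = 1"
  | Q where "prob_space Q" "sets Q = sets P" "\<And>K. sigma_compactin T K \<Longrightarrow> emeasure Q K = 0"
proof -
  interpret prob_space P by (rule P)
  have mK: "K \<in> sets P" if "sigma_compactin T K" for K
    using sigma_compactin_borel[OF T that] sets by simp
  define V where "V = measure P ` {K. sigma_compactin T K}"
  have "sigma_compactin T {}"
    unfolding sigma_compactin_def by (intro exI[of _ "\<lambda>_. {}"]) auto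
  then have ne: "V \<noteq> {}" unfolding V_def by blast
  have bdd: "bdd_above V" unfolding V_def by (auto intro!: bdd_aboveI[of _ 1])
  have upper: "measure P K \<le> Sup V" if "sigma_compactin T K" for K
    using that bdd unfolding V_def by (auto intro!: cSup_upper)
  \<comment> \<open>A maximising sequence; its union is again \<sigma>-compact and attains the
    supremum.\<close>
  have "\<exists>K. sigma_compactin T K \<and> Sup V - 1 / real (Suc n) < measure P K" for n
    using less_cSup_iff[OF ne bdd, THEN iffD1, of "Sup V - 1 / real (Suc n)"] by (auto simp: V_def)
  then obtain K where K: "\<And>n. sigma_compactin T (K n)" "\<And>n. Sup V - 1 / real (Suc n) < measure P (K n)"
    by metis
  define L where "L = (\<Union>n. K n)"
  have L: "sigma_compactin T L" unfolding L_def by (rule sigma_compactin_UN) (rule K)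
  have "measure P L = Sup V"
  proof (rule antisym[OF upper[OF L]])
    show "Sup V \<le> measure P L"
    proof (rule field_le_epsilon)
      fix e :: real assume "e > 0"
      then obtain n where n: "1 / real (Suc n) < e"
        using reals_Archimedean[of e] by (auto simp: inverse_eq_divide)
      have "measure P (K n) \<le> measure P L"
        by (rule finite_measure_mono[OF _ mK[OF L]]) (auto simp: L_def)
      then show "Sup V \<le> measure P L + e" using K(2)[of n] n by linarith
    qed
  qed
  note max = this
  show thesis
  proof (cases "measure P L = 1")
    case True
    then show thesis using L that(1) by blast
  next
    case False
    define A where "A = space P - L"
    have A: "A \<in> sets P" using mK[OF L] unfolding A_def by auto
    have Apos: "measure P A > 0"
      using False prob_compl[OF mK[OF L]] prob_le_1[of L] unfolding A_def by linarith
    then have Ane: "emeasure P A \<noteq> 0" by (simp add: emeasure_eq_measure)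
    show thesis
    proof (rule that(2)[of "uniform_measure P A"])
      show "prob_space (uniform_measure P A)"
        using Ane by (intro prob_space_uniform_measure) auto
      show "sets (uniform_measure P A) = sets P" by simp
      fix K' assume K': "sigma_compactin T K'"
      \<comment> \<open>If \<open>K'\<close> carried mass outside \<open>L\<close>, the
        \<sigma>-compact set \<open>L \<union> K'\<close> would exceed the supremum.\<close>
      have "measure P L + measure P (A \<inter> K') = measure P (L \<union> (A \<inter> K'))"
        using A mK[OF L] mK[OF K'] by (intro finite_measure_Union[symmetric]) (auto simp: A_def)
      also have "L \<union> (A \<inter> K') = L \<union> K'"
        using sets.sets_into_space[OF mK[OF K']] by (auto simp: A_def)
      also have "measure P (L \<union> K') \<le> measure P L"
        using upper[OF sigma_compactin_Un[OF L K']] max by simp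
      finally have "measure P (A \<inter> K') = 0" using measure_nonneg[of P "A \<inter> K'"] by linarith
      then have "emeasure P (A \<inter> K') = 0" by (simp add: emeasure_eq_measure)
      then show "emeasure (uniform_measure P A) K' = 0"
        using A mK[OF K'] by simp
    qed
  qed
qed

section \<open>Joint measurability of kernels over \<sigma>-compact sets\<close>

lemma continuous_map_partial:
  assumes "continuous_map (prod_topology T T) euclideanreal (\<lambda>(x, y). k x y)"
  shows "x \<in> topspace T \<Longrightarrow> continuous_map T euclideanreal (k x)"
    and "y \<in> topspace T \<Longrightarrow> continuous_map T euclideanreal (\<lambda>x. k x y)"
proof -
  show "continuous_map T euclideanreal (k x)" if "x \<in> topspace T"
    using continuous_map_compose[OF continuous_map_pairedI[of T T "\<lambda>_. x" T "\<lambda>y. y"] assms] that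
    by (simp add: o_def)
  show "continuous_map T euclideanreal (\<lambda>x. k x y)" if "y \<in> topspace T"
    using continuous_map_compose[OF continuous_map_pairedI[of T T "\<lambda>x. x" T "\<lambda>_. y"] assms] that
    by (simp add: o_def)
qed

text \<open>Compact sets are totally bounded, so finite nets at all radii \<open>1 / (q + 1)\<close>
  combine to a countable dense family. \<open>K\<close> is nonempty so that the family can be
  enumerated as a sequence.\<close>

lemma sigma_compactin_countable_net:
  assumes "Metric_space S \<rho>" and K: "sigma_compactin (Metric_space.mtopology S \<rho>) K" "K \<noteq> {}"
  obtains a :: "nat \<Rightarrow> 'x" where "\<And>i. a i \<in> S" "\<And>x e. x \<in> K \<Longrightarrow> e > 0 \<Longrightarrow> \<exists>i. \<rho> (a i) x < e"
proof -
  interpret Metric_space S \<rho> by fact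
  obtain L where L: "\<And>m::nat. compactin mtopology (L m)" "K = (\<Union>m. L m)"
    using K unfolding sigma_compactin_def by blast
  have "\<exists>F. finite F \<and> F \<subseteq> L m \<and> L m \<subseteq> (\<Union>x\<in>F. mball x (1 / real (Suc q)))" for m q
    using compactin_imp_mtotally_bounded[OF L(1)[of m]] unfolding mtotally_bounded_def by simp
  then obtain F where F: "\<And>m q. finite (F m q)" "\<And>m q. F m q \<subseteq> L m"
      "\<And>m q. L m \<subseteq> (\<Union>x\<in>F m q. mball x (1 / real (Suc q)))" by metis
  define A where "A = (\<Union>m q. F m q)"
  have cA: "countable A" unfolding A_def by (intro countable_UN countableI_type countable_finite F(1))
  have net: "\<exists>c\<in>A. c \<in> S \<and> \<rho> c x < e" if x: "x \<in> K" and e: "e > 0" for x e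
  proof -
    obtain m where m: "x \<in> L m" using x L(2) by blast
    obtain q where q: "1 / real (Suc q) < e" using reals_Archimedean[OF e] by (auto simp: inverse_eq_divide)
    obtain c where "c \<in> F m q" "x \<in> mball c (1 / real (Suc q))" using F(3)[of m q] m by blast
    then show ?thesis using q by (intro bexI[of _ c]) (auto simp: A_def)
  qed
  have AS: "A \<subseteq> S"
    unfolding A_def using F(2) compactin_subset_topspace[OF L(1)] by force
  have "A \<noteq> {}" using net[of _ 1] K(2) by fastforce
  then have rng: "range (from_nat_into A) = A" using cA by (simp add: range_from_nat_into)
  show thesis
  proof (rule that[of "from_nat_into A"])
    show "from_nat_into A i \<in> S" for i using rng AS by blast
    show "\<exists>i. \<rho> (from_nat_into A i) x < e" if "x \<in> K" "e > 0" for x e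
      using net[OF that] rng by (metis rangeE)
  qed
qed

text \<open>Without separability the Borel sets of a product may exceed the product of the Borel sets,
  so a continuous kernel need not be jointly measurable; over a \<open>\<sigma>\<close>-compact set it is.\<close>

lemma kernel_restrict_measurable:
  assumes met: "metrizable_space T" and K: "sigma_compactin T K"
    and k: "continuous_map (prod_topology T T) euclideanreal (\<lambda>(x, y). k x y)"
  shows "(\<lambda>(x, y). if x \<in> K then k x y else 0) \<in>
    borel_measurable (borel_of_topology T \<Otimes>\<^sub>M borel_of_topology T)"
proof (cases "K = {}")
  case False
  let ?B = "borel_of_topology T"
  obtain S \<rho> where ms: "Metric_space S \<rho>" and T: "T = Metric_space.mtopology S \<rho>"
    using met unfolding metrizable_space_def by blast
  interpret Metric_space S \<rho> by (rule ms)
  have S: "topspace T = S" unfolding T by simp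
  obtain a where a: "\<And>i::nat. a i \<in> S" "\<And>x e. x \<in> K \<Longrightarrow> e > 0 \<Longrightarrow> \<exists>i. \<rho> (a i) x < e"
    using sigma_compactin_countable_net[OF ms K[unfolded T] False] by blast
  have [measurable]: "K \<in> sets ?B"
    using sigma_compactin_borel[OF metrizable_imp_Hausdorff_space[OF met] K] .
  have KS: "K \<subseteq> S" using sets.sets_into_space[OF \<open>K \<in> sets ?B\<close>] S by simp
  \<comment> \<open>\<open>near m x\<close> is the first net point within \<open>1 / (m + 1)\<close>
    of \<open>x\<close>. Replacing \<open>x\<close> by it leaves countably many values in the first
    argument, so measurability in the second suffices; continuity in the first argument gives the
    limit.\<close>
  define near where "near m x = (LEAST i. \<rho> (a i) x < 1 / real (Suc m))" for m x
  have near: "\<rho> (a (near m x)) x < 1 / real (Suc m)" if "x \<in> K" for m x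
    unfolding near_def by (rule LeastI_ex) (use a(2)[OF that] in simp)
  have ball: "{x \<in> space ?B. \<rho> (a i) x < e} \<in> sets ?B" for i e
  proof -
    have "{x \<in> space ?B. \<rho> (a i) x < e} = mball (a i) e"
      using a(1) unfolding space_borel_of_topology S by auto
    then show ?thesis using openin_in_borel[of T "mball (a i) e"] T by simp
  qed
  have near_meas: "near m \<in> measurable ?B (count_space UNIV)" for m
    unfolding near_def by (rule measurable_Least) (use ball in \<open>simp add: pred_def\<close>)
  show ?thesis
  proof (rule borel_measurable_LIMSEQ_real)
    show "(\<lambda>p. if fst p \<in> K then k (a (near m (fst p))) (snd p) else 0) \<in> borel_measurable (?B \<Otimes>\<^sub>M ?B)" for m
    proof (rule measurable_compose_countable'[where I = UNIV and g = "\<lambda>p. near m (fst p)"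
          and f = "\<lambda>i p. if fst p \<in> K then k (a i) (snd p) else 0"])
      show "(\<lambda>p. near m (fst p)) \<in> measurable (?B \<Otimes>\<^sub>M ?B) (count_space UNIV)"
        using near_meas by measurable
      fix i
      have [measurable]: "k (a i) \<in> borel_measurable ?B"
        using continuous_map_partial(1)[OF k] a(1) S by (simp add: continuous_map_borel_measurable)
      show "(\<lambda>p. if fst p \<in> K then k (a i) (snd p) else 0) \<in> borel_measurable (?B \<Otimes>\<^sub>M ?B)"
        by measurable
    qed simp
    fix p assume "p \<in> space (?B \<Otimes>\<^sub>M ?B)"
    then obtain x y where p: "p = (x, y)" and xy: "x \<in> S" "y \<in> S"
      by (auto simp: space_pair_measure S)
    show "(\<lambda>m. if fst p \<in> K then k (a (near m (fst p))) (snd p) else 0)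
      \<longlonglongrightarrow> (case p of (x, y) \<Rightarrow> if x \<in> K then k x y else 0)"
    proof (cases "x \<in> K")
      case True
      have "limitin T (\<lambda>m. a (near m x)) x sequentially"
        unfolding T limitin_metric
      proof (intro conjI allI impI)
        show "x \<in> S" by (rule xy)
        fix e :: real assume "e > 0"
        then have "\<forall>\<^sub>F m in sequentially. 1 / real (Suc m) < e" by real_asymp
        then show "\<forall>\<^sub>F m in sequentially. a (near m x) \<in> S \<and> \<rho> (a (near m x)) x < e"
          by eventually_elim (use near[OF True] a(1) in \<open>auto intro: less_trans\<close>)
      qed
      then have "(\<lambda>m. k (a (near m x)) y) \<longlonglongrightarrow> k x y"
        using continuous_map_limit[OF continuous_map_partial(2)[OF k, of y]] xy S
        by (force simp: o_def)
      then show ?thesis using True p by simp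
    qed (simp add: p)
  qed
qed simp

section \<open>Characteristic tensor product kernels\<close>

locale tensor_setting =
  fixes d :: nat and T :: "nat \<Rightarrow> 'a topology" and k :: "nat \<Rightarrow> 'a \<Rightarrow> 'a \<Rightarrow> real"
  assumes metrizable: "j \<in> {1..d} \<Longrightarrow> metrizable_space (T j)"
    and universal: "j \<in> {1..d} \<Longrightarrow> c0_universal (T j) (k j)"
    and characteristic: "characteristic_kernel (PiM {1..d} (\<lambda>j. borel_of_topology (T j))) (tensor_kernel d k)"
begin

abbreviation B where "B \<equiv> \<lambda>j. borel_of_topology (T j)"
abbreviation S where "S \<equiv> \<lambda>j. topspace (T j)"
abbreviation \<Omega> where "\<Omega> \<equiv> PiM {1..d} B"

lemma space_\<Omega>: "space \<Omega> = PiE {1..d} S"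
  by (simp add: space_PiM)

lemma Hausdorff: "j \<in> {1..d} \<Longrightarrow> Hausdorff_space (T j)"
  by (rule metrizable_imp_Hausdorff_space[OF metrizable])

lemma kernel_continuous:
  "j \<in> {1..d} \<Longrightarrow> continuous_map (prod_topology (T j) (T j)) euclideanreal (\<lambda>(x, y). k j x y)"
  using universal by (auto simp: c0_universal_def)

lemma section_C0: "j \<in> {1..d} \<Longrightarrow> x \<in> S j \<Longrightarrow> kernel_section (S j) (k j) x \<in> C0_space (T j)"
  using universal[of j] unfolding c0_universal_def is_rkhs_def by blast

lemma section_bounded:
  assumes "j \<in> {1..d}" "x \<in> S j"
  obtains b where "\<And>y. y \<in> S j \<Longrightarrow> \<bar>k j x y\<bar> \<le> b"
  using C0_space_bounded[OF section_C0[OF assms]] by (metis kernel_section_def)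

lemma section_measurable: "j \<in> {1..d} \<Longrightarrow> x \<in> S j \<Longrightarrow> k j x \<in> borel_measurable (B j)"
  by (rule continuous_map_borel_measurable[OF continuous_map_partial(1)[OF kernel_continuous]])

lemma component_update_measurable:
  assumes "z \<in> PiE {1..d} S" "j \<in> {1..d}"
  shows "(\<lambda>y. z(j := y)) \<in> measurable (B j) \<Omega>"
proof (rule measurable_PiM_single')
  show "(\<lambda>y. (z(j := y)) i) \<in> measurable (B j) (B i)" if "i \<in> {1..d}" for i
    using that assms PiE_mem[OF assms(1) that] by (cases "i = j") simp_all
  show "(\<lambda>y. z(j := y)) \<in> space (B j) \<rightarrow> (\<Pi>\<^sub>E i\<in>{1..d}. space (B i))"
    using assms by (auto simp: PiE_iff extensional_def)
qed

text \<open>If \<open>Q\<close> does not charge \<open>\<sigma>\<close>-compact sets, functions vanishing at infinity integrate to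
  \<open>0\<close>, so \<open>Q\<close> in component \<open>j\<close> combined with arbitrary point masses in the others has embedding \<open>0\<close>.\<close>

lemma no_diffuse_component:
  assumes Q: "prob_space Q" "sets Q = sets (B j)" "\<And>K. sigma_compactin (T j) K \<Longrightarrow> emeasure Q K = 0"
    and z: "z \<in> PiE {1..d} S" "z' \<in> PiE {1..d} S" and j: "j \<in> {1..d}" and l: "l \<in> {1..d}" "l \<noteq> j"
    and ne: "z l \<noteq> z' l"
  shows False
proof -
  obtain H ip where rk: "is_rkhs (space \<Omega>) (tensor_kernel d k) H ip"
    and emb: "\<And>P. prob_space P \<Longrightarrow> sets P = sets \<Omega> \<Longrightarrow> \<exists>\<mu>. mean_embedding H ip P \<mu>"
    and char: "\<And>P Q \<mu> \<nu>. prob_space P \<Longrightarrow> sets P = sets \<Omega> \<Longrightarrow> prob_space Q \<Longrightarrow> sets Q = sets \<Omega> \<Longrightarrow>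
            mean_embedding H ip P \<mu> \<Longrightarrow> mean_embedding H ip Q \<nu> \<Longrightarrow>
            (sqrt (ip (\<lambda>x. \<mu> x - \<nu> x) (\<lambda>x. \<mu> x - \<nu> x)) = 0 \<longleftrightarrow> P = Q)"
    using characteristic unfolding characteristic_kernel_def by blast
  interpret rkhs "space \<Omega>" "tensor_kernel d k" H ip by standard (rule rk)
  define W where "W z = distr Q \<Omega> (\<lambda>y. z(j := y))" for z
  have meas: "(\<lambda>y. z(j := y)) \<in> measurable Q \<Omega>" if "z \<in> PiE {1..d} S" for z
    using component_update_measurable[OF that j] by (simp add: measurable_cong_sets[OF Q(2) refl])
  have W: "prob_space (W z)" "sets (W z) = sets \<Omega>" if "z \<in> PiE {1..d} S" for z
    using prob_space.prob_space_distr[OF Q(1) meas[OF that]] unfolding W_def by auto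
  \<comment> \<open>The section at \<open>x\<close> integrates to \<open>0\<close> under
    \<open>W z\<close>, and by the reproducing property this integral is the value
    \<open>\<mu> x\<close>.\<close>
  have zero: "\<mu> = (\<lambda>x. 0)" if z: "z \<in> PiE {1..d} S" and \<mu>: "mean_embedding H ip (W z) \<mu>" for z \<mu>
  proof
    fix x
    show "\<mu> x = 0"
    proof (cases "x \<in> space \<Omega>")
      case True
      let ?f = "kernel_section (space \<Omega>) (tensor_kernel d k) x"
      have f: "?f \<in> H" by (rule section_in[OF True])
      have \<mu>H: "\<mu> \<in> H" and int: "integrable (W z) ?f" "(\<integral>y. ?f y \<partial>W z) = ip ?f \<mu>"
        using \<mu> f unfolding mean_embedding_def by auto
      have "?f \<in> borel_measurable \<Omega>"
        using borel_measurable_integrable[OF int(1)] measurable_cong_sets[OF W(2)[OF z] refl] by blast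
      then have "(\<integral>y. ?f y \<partial>W z) = (\<integral>y. ?f (z(j := y)) \<partial>Q)"
        unfolding W_def by (rule integral_distr[OF meas[OF z]])
      also have "\<dots> = 0"
      proof (rule integral_eq_zero_AE)
        have xj: "x j \<in> S j" using PiE_mem[OF True[unfolded space_\<Omega>] j] .
        \<comment> \<open>The section of \<open>k j\<close> is nonzero only on a \<sigma>-compact
          set, which is \<open>Q\<close>-null; elsewhere a single zero factor annihilates the tensor
          product.\<close>
        let ?N = "{y. kernel_section (S j) (k j) (x j) y \<noteq> 0}"
        have sc: "sigma_compactin (T j) ?N" by (rule C0_space_support[OF section_C0[OF j xj]])
        have "AE y in Q. y \<notin> ?N"
          using Q(3)[OF sc] sigma_compactin_borel[OF Hausdorff[OF j] sc] Q(2)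
          by (intro AE_not_in) (auto simp: null_sets_def)
        then show "AE y in Q. ?f (z(j := y)) = 0"
        proof eventually_elim
          case (elim y)
          have "k j (x j) y = 0" if "y \<in> S j" using elim that by (simp add: kernel_section_def)
          moreover have "y \<in> S j" if "z(j := y) \<in> space \<Omega>"
            using PiE_mem[OF that[unfolded space_\<Omega>] j] by simp
          ultimately show ?case using j unfolding kernel_section_def tensor_kernel_def
            by (auto intro!: prod_zero bexI[of _ j])
        qed
      qed
      finally show ?thesis using int(2) reproducing[OF True \<mu>H] ip_sym[OF \<mu>H f] by simp
    next
      case False
      then show ?thesis using \<mu> outside unfolding mean_embedding_def by blast
    qed
  qed
  obtain \<mu> \<nu> where \<mu>: "mean_embedding H ip (W z) \<mu>" and \<nu>: "mean_embedding H ip (W z') \<nu>"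
    using emb W z by meson
  have "W z = W z'"
    using char[OF W[OF z(1)] W[OF z(2)] \<mu> \<nu>] zero[OF z(1) \<mu>] zero[OF z(2) \<nu>] ip_zero by simp
  moreover have "W z \<noteq> W z'"
  proof -
    have zl: "z l \<in> S l" using z l by auto
    \<comment> \<open>Coordinate \<open>l\<close> is constantly \<open>z l\<close> under
      \<open>W z\<close> and \<open>z' l\<close> under \<open>W z'\<close>. Points are closed, hence
      measurable, so \<open>A\<close> separates the two laws.\<close>
    define A where "A = (\<lambda>x. x l) -` {z l} \<inter> space \<Omega>"
    have "{z l} \<in> sets (B l)"
      using zl Hausdorff_imp_t1_space[OF Hausdorff[OF l(1)]] by (intro closedin_in_borel) (auto simp: closedin_t1_singleton)
    then have A: "A \<in> sets \<Omega>" unfolding A_def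
      by (rule measurable_sets[OF measurable_component_singleton[OF l(1)]])
    have em: "emeasure (W w) A = emeasure Q {y \<in> space Q. w l = z l}" if w: "w \<in> PiE {1..d} S" for w
    proof -
      have "(\<lambda>y. w(j := y)) -` A \<inter> space Q = {y \<in> space Q. w l = z l}"
        using l(2) measurable_space[OF meas[OF w]] by (auto simp: A_def)
      then show ?thesis unfolding W_def using emeasure_distr[OF meas[OF w] A] by simp
    qed
    have "emeasure (W z) A = 1" using em[OF z(1)] prob_space.emeasure_space_1[OF Q(1)] by simp
    moreover have "emeasure (W z') A = 0" using em[OF z(2)] ne by simp
    ultimately show ?thesis by auto
  qed
  ultimately show False by simp
qed

end

text \<open>Used in the contrapositive: dependence yields a component besides \<open>j\<close> with
  two distinct points. If there were none, every nonempty rectangle would be an event about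
  coordinate \<open>j\<close> alone.\<close>

lemma product_law_if_other_components_trivial:
  fixes B :: "'i \<Rightarrow> 'a measure"
  assumes M: "prob_space M" and X: "X \<in> measurable M (PiM I B)" and I: "finite I" and j: "j \<in> I"
    and triv: "\<And>l x y. l \<in> I \<Longrightarrow> l \<noteq> j \<Longrightarrow> x \<in> space (B l) \<Longrightarrow> y \<in> space (B l) \<Longrightarrow> x = y"
  shows "distr M (PiM I B) X = PiM I (\<lambda>j. distr M (B j) (\<lambda>\<omega>. X \<omega> j))"
proof -
  interpret prob_space M by (rule M)
  have Xc [measurable]: "(\<lambda>\<omega>. X \<omega> i) \<in> measurable M (B i)" if "i \<in> I" for i
    using measurable_compose[OF X measurable_component_singleton[OF that]] .
  \<comment> \<open>\<open>product_sigma_finite\<close> asks for a measure at every index, so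
    indices outside \<open>I\<close> receive a point mass as a default.\<close>
  define N where "N i = (if i \<in> I then distr M (B i) (\<lambda>\<omega>. X \<omega> i) else return (count_space UNIV) undefined)" for i
  have Np: "prob_space (N i)" for i
    by (cases "i \<in> I") (simp_all add: N_def prob_space_distr prob_space_return)
  interpret N: product_sigma_finite N
    by (intro product_sigma_finite.intro prob_space_imp_sigma_finite Np)
  have sets_eq: "sets (PiM I N) = sets (PiM I B)"
    by (intro sets_PiM_cong) (auto simp: N_def)
  have "distr M (PiM I B) X = PiM I N"
  proof (rule N.PiM_eqI[OF I])
    show "sets (distr M (PiM I B) X) = sets (PiM I N)" using sets_eq by simp
    fix A assume A: "\<And>i. i \<in> I \<Longrightarrow> A i \<in> sets (N i)"
    then have AB: "A i \<in> sets (B i)" if "i \<in> I" for i using that by (auto simp: N_def)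
    have em: "emeasure (N i) (A i) = emeasure M {\<omega> \<in> space M. X \<omega> i \<in> A i}" if "i \<in> I" for i
    proof -
      have "(\<lambda>\<omega>. X \<omega> i) -` A i \<inter> space M = {\<omega> \<in> space M. X \<omega> i \<in> A i}" by auto
      then show ?thesis using emeasure_distr[OF Xc[OF that] AB[OF that]] that by (simp add: N_def)
    qed
    have PA: "PiE I A \<in> sets (PiM I B)" using AB I by (intro sets_PiM_I_finite) auto
    have XE: "X \<omega> \<in> PiE I (\<lambda>i. space (B i))" if "\<omega> \<in> space M" for \<omega>
      using measurable_space[OF X that] by (simp add: space_PiM)
    have "emeasure (distr M (PiM I B) X) (PiE I A) = emeasure M {\<omega> \<in> space M. \<forall>i\<in>I. X \<omega> i \<in> A i}"
    proof -
      have "X -` PiE I A \<inter> space M = {\<omega> \<in> space M. \<forall>i\<in>I. X \<omega> i \<in> A i}"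
        using XE by (auto simp: PiE_iff)
      then show ?thesis using emeasure_distr[OF X PA] by simp
    qed
    also have "\<dots> = (\<Prod>i\<in>I. emeasure (N i) (A i))"
    proof (cases "\<exists>l\<in>I. A l = {}")
      case True
      then obtain l where l: "l \<in> I" "A l = {}" by blast
      then have "(\<Prod>i\<in>I. emeasure (N i) (A i)) = 0" using I by (intro prod_zero bexI[of _ l]) auto
      moreover have "{\<omega> \<in> space M. \<forall>i\<in>I. X \<omega> i \<in> A i} = {}" using l by auto
      ultimately show ?thesis by (simp only: emeasure_empty)
    next
      case False
      \<comment> \<open>A nonempty side in a component with at most one point contains the value of
        \<open>X\<close> there and imposes no condition.\<close>
      have full: "X \<omega> l \<in> A l" if "\<omega> \<in> space M" "l \<in> I" "l \<noteq> j" for \<omega> l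
      proof -
        have "A l \<noteq> {}" using False that(2) by blast
        then obtain a where a: "a \<in> A l" by blast
        then have "a \<in> space (B l)" using sets.sets_into_space[OF AB[OF that(2)]] by blast
        moreover have "X \<omega> l \<in> space (B l)" by (rule PiE_mem[OF XE[OF that(1)] that(2)])
        ultimately have "X \<omega> l = a" by (intro triv[OF that(2,3)])
        then show ?thesis using a by simp
      qed
      have "{\<omega> \<in> space M. \<forall>i\<in>I. X \<omega> i \<in> A i} = {\<omega> \<in> space M. X \<omega> j \<in> A j}"
      proof (intro Collect_cong conj_cong refl iffI ballI)
        fix \<omega> i assume "\<omega> \<in> space M" "X \<omega> j \<in> A j" "i \<in> I"
        then show "X \<omega> i \<in> A i" using full by (cases "i = j") simp_all
      qed (rule bspec[OF _ j])
      moreover have "(\<Prod>i\<in>I. emeasure (N i) (A i)) = emeasure (N j) (A j) * (\<Prod>i\<in>I - {j}. emeasure (N i) (A i))"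
        by (rule prod.remove[OF I j])
      moreover have one: "emeasure (N i) (A i) = 1" if "i \<in> I - {j}" for i
      proof -
        have "{\<omega> \<in> space M. X \<omega> i \<in> A i} = space M" using full that by auto
        then show ?thesis using em[of i] that emeasure_space_1 by simp
      qed
      moreover have "(\<Prod>i\<in>I - {j}. emeasure (N i) (A i)) = 1"
        by (intro prod.neutral ballI one)
      ultimately show ?thesis using em[OF j] by (simp only: mult_1_right)
    qed
    finally show "emeasure (distr M (PiM I B) X) (PiE I A) = (\<Prod>i\<in>I. emeasure (N i) (A i))" .
  qed
  also have "PiM I N = PiM I (\<lambda>j. distr M (B j) (\<lambda>\<omega>. X \<omega> j))"
    by (intro PiM_cong) (auto simp: N_def)
  finally show ?thesis .
qed

section \<open>Dependent samples\<close>

text \<open>Continuity of a finite product, by contradiction with sequences; it turns closeness of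
  the marginal averages into closeness of their product.\<close>

lemma prod_continuity_modulus:
  fixes b :: "'i \<Rightarrow> real"
  assumes "finite J" "e > 0"
  obtains \<eta> where "\<eta> > 0" "\<And>a. (\<And>j. j \<in> J \<Longrightarrow> \<bar>a j - b j\<bar> < \<eta>) \<Longrightarrow> \<bar>(\<Prod>j\<in>J. a j) - (\<Prod>j\<in>J. b j)\<bar> < e"
proof (rule ccontr)
  assume none: "\<not> thesis"
  have "\<exists>a. (\<forall>j\<in>J. \<bar>a j - b j\<bar> < 1 / real (Suc m)) \<and> \<not> \<bar>(\<Prod>j\<in>J. a j) - (\<Prod>j\<in>J. b j)\<bar> < e" for m
    using that[of "1 / real (Suc m)"] none by (metis zero_less_divide_1_iff of_nat_0_less_iff zero_less_Suc)
  then obtain a where a: "\<And>m j. j \<in> J \<Longrightarrow> \<bar>a m j - b j\<bar> < 1 / real (Suc m)"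
      "\<And>m. \<not> \<bar>(\<Prod>j\<in>J. a m j) - (\<Prod>j\<in>J. b j)\<bar> < e"
    by metis
  have "(\<lambda>m. a m j) \<longlonglongrightarrow> b j" if "j \<in> J" for j
  proof (rule LIMSEQ_I)
    fix r :: real assume "r > 0"
    then obtain N where N: "1 / real (Suc N) < r" using reals_Archimedean by (auto simp: inverse_eq_divide)
    have "norm (a m j - b j) < r" if "m \<ge> N" for m
    proof -
      have "1 / real (Suc m) \<le> 1 / real (Suc N)" using that by (simp add: frac_le)
      then show ?thesis using a(1)[OF \<open>j \<in> J\<close>, of m] N by simp
    qed
    then show "\<exists>N. \<forall>m\<ge>N. norm (a m j - b j) < r" by blast
  qed
  then have "(\<lambda>m. \<Prod>j\<in>J. a m j) \<longlonglongrightarrow> (\<Prod>j\<in>J. b j)" by (intro tendsto_prod)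
  then have "\<exists>N. \<forall>m\<ge>N. norm ((\<Prod>j\<in>J. a m j) - (\<Prod>j\<in>J. b j)) < e"
    using assms(2) by (rule LIMSEQ_D)
  then show False using a(2) by auto
qed

text \<open>The original statistic is one of the permuted ones, so integrability of the permuted
  statistics covers it.\<close>

lemma dHSIC_hat_identity_permutation:
  "dHSIC_hat d k n (permuted_data (\<lambda>l\<in>{1..d - 1}. id) D) = dHSIC_hat d k n D"
proof -
  have "permuted_data (\<lambda>l\<in>{1..d - 1}. id) D i j = D i j" if "j \<in> {1..d}" for i j
    using that by (auto simp: permuted_data_def)
  then have "(\<Prod>j = 1..d. k j (permuted_data (\<lambda>l\<in>{1..d - 1}. id) D (a j) j)
      (permuted_data (\<lambda>l\<in>{1..d - 1}. id) D (b j) j)) = (\<Prod>j = 1..d. k j (D (a j) j) (D (b j) j))" for a b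
    by (intro prod.cong refl) (simp only:)
  then show ?thesis unfolding dHSIC_hat_def by (simp only:)
qed

lemma identity_permutation_vector: "(\<lambda>l\<in>{1..d - 1}. id) \<in> permutation_vectors d n"
  unfolding permutation_vectors_def by (auto simp: permutes_id)

text \<open>Integrability is part of \<open>moment\<close> because the Bochner integral of a
  function that is not integrable is \<open>0\<close>, so a bound on it alone would say
  nothing.\<close>

locale dependent_sample = tensor_setting d T k + prob_space M
  for d :: nat and T :: "nat \<Rightarrow> 'a topology" and k and M :: "'w measure" +
  fixes X :: "'w \<Rightarrow> nat \<Rightarrow> 'a" and Xs :: "nat \<Rightarrow> 'w \<Rightarrow> nat \<Rightarrow> 'a" and C :: real
  assumes d: "d \<ge> 2"
    and X: "X \<in> measurable M \<Omega>"
    and dependent: "distr M \<Omega> X \<noteq> PiM {1..d} (\<lambda>j. distr M (B j) (\<lambda>\<omega>. X \<omega> j))"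
    and indep: "indep_vars (\<lambda>_. \<Omega>) Xs {1..}"
    and ident: "m \<ge> 1 \<Longrightarrow> distr M \<Omega> (Xs m) = distr M \<Omega> X"
    and moment: "n \<ge> 2 * d \<Longrightarrow> i \<in> index_tuples (2 * d) n \<Longrightarrow>
          integrable M (\<lambda>\<omega>. slot_product d k (\<lambda>m. Xs m \<omega>) i) \<and>
          (\<integral>\<omega>. \<bar>slot_product d k (\<lambda>m. Xs m \<omega>) i\<bar> \<partial>M) < C"
begin

definition P where "P = distr M \<Omega> X"

lemma Xs_measurable: "m \<ge> 1 \<Longrightarrow> Xs m \<in> measurable M \<Omega>"
  using indep by (auto simp: indep_vars_def)

lemma prob_space_P: "prob_space P"
  unfolding P_def by (rule prob_space_distr[OF X])

lemma Xs_component: "m \<ge> 1 \<Longrightarrow> j \<in> {1..d} \<Longrightarrow> \<omega> \<in> space M \<Longrightarrow> Xs m \<omega> j \<in> S j"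
  using measurable_space[OF Xs_measurable, of m \<omega>] unfolding space_\<Omega> by (rule PiE_mem)

lemma X_component_measurable: "j \<in> {1..d} \<Longrightarrow> (\<lambda>\<omega>. X \<omega> j) \<in> measurable M (B j)"
  by (rule measurable_compose[OF X measurable_component_singleton])

text \<open>Otherwise the dichotomy gives a measure \<open>Q\<close> charging no \<sigma>-compact
  set. Dependence provides another component \<open>l\<close> with two distinct points, and
  \<open>no_diffuse_component\<close> then contradicts the characteristic property.\<close>

lemma components_sigma_compact:
  assumes j: "j \<in> {1..d}"
  obtains K where "sigma_compactin (T j) K" "AE y in P. y j \<in> K"
proof -
  let ?Pj = "distr M (B j) (\<lambda>\<omega>. X \<omega> j)"
  note Xj = X_component_measurable[OF j]
  have Pj: "prob_space ?Pj" by (rule prob_space_distr[OF Xj])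
  from sigma_compact_dichotomy[OF Pj sets_distr Hausdorff[OF j]]
  show thesis
  proof cases
    case (1 K)
    have K: "K \<in> sets (B j)" by (rule sigma_compactin_borel[OF Hausdorff[OF j] 1(1)])
    have "AE x in ?Pj. x \<in> K"
      using prob_space.AE_in_set_eq_1[OF Pj] K 1(2) by simp
    then have "AE \<omega> in M. X \<omega> j \<in> K"
      using AE_distr_iff[OF Xj, of "\<lambda>x. x \<in> K"] K sets.Int_space_eq2[OF K] by (simp add: Int_def conj_commute)
    moreover have "{y \<in> space \<Omega>. y j \<in> K} \<in> sets \<Omega>"
      using measurable_sets[OF measurable_component_singleton[OF j, of B] K] by (simp add: vimage_def Int_def conj_commute)
    ultimately have "AE y in P. y j \<in> K" unfolding P_def by (subst AE_distr_iff[OF X])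
    then show thesis using 1(1) that by blast
  next
    case (2 Q)
    obtain \<omega> where \<omega>: "\<omega> \<in> space M" using not_empty by blast
    define z where "z = X \<omega>"
    have z: "z \<in> PiE {1..d} S" using measurable_space[OF X \<omega>] unfolding z_def space_\<Omega> .
    obtain l x y where l: "l \<in> {1..d}" "l \<noteq> j" and xy: "x \<in> S l" "y \<in> S l" "x \<noteq> y"
      using product_law_if_other_components_trivial[OF prob_space_axioms X finite_atLeastAtMost j] dependent
      by (metis space_borel_of_topology)
    have upd: "z(l := w) \<in> PiE {1..d} S" if "w \<in> S l" for w
      using z l that by (auto simp: PiE_iff extensional_def)
    have "False"
      by (rule no_diffuse_component[of Q j "z(l := x)" "z(l := y)" l])
        (use 2 upd xy l j in auto)
    then show thesis ..
  qed
qed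

text \<open>The joint law of the first \<open>n\<close> observations is a product; pulling it back
  along the injective \<open>t\<close> selects distinct, hence independent, coordinates.\<close>

lemma sample_law:
  assumes t: "t \<in> {1..q} \<rightarrow> {1..n}" "inj_on t {1..q}" and n: "n \<ge> 1"
  shows "(\<lambda>\<omega>. \<lambda>m\<in>{1..q}. Xs (t m) \<omega>) \<in> measurable M (PiM {1..q} (\<lambda>_. \<Omega>))"
    and "distr M (PiM {1..q} (\<lambda>_. \<Omega>)) (\<lambda>\<omega>. \<lambda>m\<in>{1..q}. Xs (t m) \<omega>) = PiM {1..q} (\<lambda>_. P)"
proof -
  have t1: "t m \<ge> 1" if "m \<in> {1..q}" for m using t(1) that by fastforce
  show "(\<lambda>\<omega>. \<lambda>m\<in>{1..q}. Xs (t m) \<omega>) \<in> measurable M (PiM {1..q} (\<lambda>_. \<Omega>))"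
    by (intro measurable_restrict Xs_measurable t1)
  let ?N = "PiM {1..n} (\<lambda>_. \<Omega>)" and ?Q = "PiM {1..q} (\<lambda>_. \<Omega>)"
  have J: "(\<lambda>\<omega>. \<lambda>i\<in>{1..n}. Xs i \<omega>) \<in> measurable M ?N"
    by (intro measurable_restrict Xs_measurable) auto
  have "indep_vars (\<lambda>_. \<Omega>) Xs {1..n}" by (rule indep_vars_subset[OF indep]) auto
  then have "distr M ?N (\<lambda>\<omega>. \<lambda>i\<in>{1..n}. Xs i \<omega>) = PiM {1..n} (\<lambda>i. distr M \<Omega> (Xs i))"
  proof (subst (asm) indep_vars_iff_distr_eq_PiM')
    show "Xs i \<in> measurable M \<Omega>" if "i \<in> {1..n}" for i
      by (rule Xs_measurable) (use that in simp)
  qed (use n in auto)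
  also have "\<dots> = PiM {1..n} (\<lambda>_. P)"
    using ident by (intro PiM_cong) (auto simp: P_def)
  finally have joint: "distr M ?N (\<lambda>\<omega>. \<lambda>i\<in>{1..n}. Xs i \<omega>) = PiM {1..n} (\<lambda>_. P)" .
  have setsP: "sets (PiM {1..q} (\<lambda>_. P)) = sets ?Q" by (intro sets_PiM_cong) (auto simp: P_def)
  have R: "(\<lambda>y. \<lambda>m\<in>{1..q}. y (t m)) \<in> measurable ?N ?Q"
    using t(1) by (intro measurable_restrict measurable_component_singleton) auto
  have "PiM {1..q} (\<lambda>_. P) = distr (PiM {1..n} (\<lambda>_. P)) (PiM {1..q} (\<lambda>_. P)) (\<lambda>y. \<lambda>m\<in>{1..q}. y (t m))"
    using distr_PiM_reindex[of "{1..n}" "\<lambda>_. P" t "{1..q}"] prob_space_P t by simp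
  also have "\<dots> = distr (distr M ?N (\<lambda>\<omega>. \<lambda>i\<in>{1..n}. Xs i \<omega>)) ?Q (\<lambda>y. \<lambda>m\<in>{1..q}. y (t m))"
    using joint setsP by (intro distr_cong) auto
  also have "\<dots> = distr M ?Q ((\<lambda>y. \<lambda>m\<in>{1..q}. y (t m)) \<circ> (\<lambda>\<omega>. \<lambda>i\<in>{1..n}. Xs i \<omega>))"
    by (rule distr_distr[OF R J])
  also have "(\<lambda>y. \<lambda>m\<in>{1..q}. y (t m)) \<circ> (\<lambda>\<omega>. \<lambda>i\<in>{1..n}. Xs i \<omega>) = (\<lambda>\<omega>. \<lambda>m\<in>{1..q}. Xs (t m) \<omega>)"
    using t(1) by (auto simp: fun_eq_iff Pi_iff)
  finally show "distr M ?Q (\<lambda>\<omega>. \<lambda>m\<in>{1..q}. Xs (t m) \<omega>) = PiM {1..q} (\<lambda>_. P)" by (rule sym)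
qed

text \<open>The restriction \<open>n \<ge> 2 * d\<close> in \<open>moment\<close> disappears because
  a tuple with entries up to \<open>n\<close> is also one with entries up to
  \<open>n + 2 * d\<close>.\<close>

lemma slot_product_integrable:
  assumes "t \<in> index_tuples (2 * d) n"
  shows "integrable M (\<lambda>\<omega>. slot_product d k (\<lambda>m. Xs m \<omega>) t)"
    and "(\<integral>\<omega>. \<bar>slot_product d k (\<lambda>m. Xs m \<omega>) t\<bar> \<partial>M) < C"
proof -
  have "t m \<in> {1..n + 2*d}" if "m \<in> {1..2*d}" for m
    using assms that unfolding index_tuples_def by fastforce
  then have "t \<in> index_tuples (2 * d) (n + 2 * d)"
    using assms unfolding index_tuples_def by (auto simp: PiE_iff)
  then show "integrable M (\<lambda>\<omega>. slot_product d k (\<lambda>m. Xs m \<omega>) t)"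
    "(\<integral>\<omega>. \<bar>slot_product d k (\<lambda>m. Xs m \<omega>) t\<bar> \<partial>M) < C"
    using moment[of "n + 2 * d" t] by auto
qed

text \<open>\<open>slot_product\<close> need not be measurable on the product space; it agrees almost surely with a
  function that is, because each component is concentrated on a \<open>\<sigma>\<close>-compact set.\<close>

lemma slot_product_expectation_const:
  obtains a where "\<And>n t. t \<in> index_tuples (2 * d) n \<Longrightarrow> inj_on t {1..2*d} \<Longrightarrow>
    (\<integral>\<omega>. slot_product d k (\<lambda>m. Xs m \<omega>) t \<partial>M) = a"
proof -
  have "\<exists>K. sigma_compactin (T j) K \<and> (AE y in P. y j \<in> K)" if "j \<in> {1..d}" for j
    using components_sigma_compact[OF that] by metis
  then obtain K where K: "\<And>j. j \<in> {1..d} \<Longrightarrow> sigma_compactin (T j) (K j)"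
    "\<And>j. j \<in> {1..d} \<Longrightarrow> AE y in P. y j \<in> K j" by metis
  \<comment> \<open>Cutting off only the first argument of each kernel already gives joint
    measurability.\<close>
  define h where "h y = (\<Prod>j = 1..d. (\<lambda>(u, v). if u \<in> K j then k j u v else 0) (y (2 * j - 1) j, y (2 * j) j))"
    for y :: "nat \<Rightarrow> nat \<Rightarrow> 'a"
  let ?Q = "PiM {1..2*d} (\<lambda>_. \<Omega>)"
  have h: "h \<in> borel_measurable ?Q"
    unfolding h_def
  proof (rule borel_measurable_prod)
    fix j assume j: "j \<in> {1..d}"
    have c: "(\<lambda>y. y m j) \<in> measurable ?Q (B j)" if "m \<in> {1..2*d}" for m
      using measurable_compose[OF measurable_component_singleton[OF that] measurable_component_singleton[OF j]] .
    have "(\<lambda>y. (y (2 * j - 1) j, y (2 * j) j)) \<in> measurable ?Q (B j \<Otimes>\<^sub>M B j)"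
      using j by (intro measurable_Pair c) auto
    then show "(\<lambda>y. (\<lambda>(u, v). if u \<in> K j then k j u v else 0) (y (2 * j - 1) j, y (2 * j) j)) \<in> borel_measurable ?Q"
      by (rule measurable_compose[OF _ kernel_restrict_measurable[OF metrizable[OF j] K(1)[OF j] kernel_continuous[OF j]]])
  qed
  have AE_K: "AE \<omega> in M. Xs m \<omega> j \<in> K j" if "m \<ge> 1" "j \<in> {1..d}" for m j
    using K(2)[OF that(2)] unfolding P_def ident[OF that(1), symmetric]
    by (rule AE_distrD[OF Xs_measurable[OF that(1)]])
  show thesis
  proof (rule that[of "\<integral>y. h y \<partial>PiM {1..2*d} (\<lambda>_. P)"])
    fix n t assume t: "t \<in> index_tuples (2 * d) n" and inj: "inj_on t {1..2*d}"
    have tf: "t \<in> {1..2*d} \<rightarrow> {1..n}" using t by (auto simp: index_tuples_def)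
    have "1 \<in> {1..2*d}" using d by auto
    then have "t 1 \<in> {1..n}" using tf by blast
    then have n: "n \<ge> 1" by simp
    have "2 * j - 1 \<in> {1..2*d}" "2 * j \<in> {1..2*d}" if "j \<in> {1..d}" for j using that by auto
    note slots = this
    then have t1: "t (2 * j - 1) \<ge> 1" if "j \<in> {1..d}" for j using tf that by fastforce
    note law = sample_law[OF tf inj n]
    have "AE \<omega> in M. \<forall>j\<in>{1..d}. Xs (t (2 * j - 1)) \<omega> j \<in> K j"
      by (intro AE_finite_allI AE_K t1) auto
    then have ae: "AE \<omega> in M. slot_product d k (\<lambda>m. Xs m \<omega>) t = h (\<lambda>m\<in>{1..2*d}. Xs (t m) \<omega>)"
    proof eventually_elim
      case (elim \<omega>)
      then show ?case unfolding slot_product_def h_def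
        using slots by (intro prod.cong) auto
    qed
    \<comment> \<open>Integrability makes the slot product measurable over \<open>M\<close>, as the
      almost sure replacement inside the integral requires.\<close>
    note int = slot_product_integrable(1)[OF t]
    have "(\<integral>\<omega>. slot_product d k (\<lambda>m. Xs m \<omega>) t \<partial>M) = (\<integral>\<omega>. h (\<lambda>m\<in>{1..2*d}. Xs (t m) \<omega>) \<partial>M)"
      using int measurable_compose[OF law(1) h] ae by (intro integral_cong_AE) auto
    also have "\<dots> = (\<integral>y. h y \<partial>distr M ?Q (\<lambda>\<omega>. \<lambda>m\<in>{1..2*d}. Xs (t m) \<omega>))"
      by (rule integral_distr[OF law(1) h, symmetric])
    finally show "(\<integral>\<omega>. slot_product d k (\<lambda>m. Xs m \<omega>) t \<partial>M) = (\<integral>y. h y \<partial>PiM {1..2*d} (\<lambda>_. P))"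
      unfolding law(2) .
  qed
qed

section \<open>The expected statistic under random permutations\<close>

lemma slot_tuple_index:
  assumes "\<psi> \<in> permutation_vectors d n"
  shows "i \<in> index_tuples 2 n \<Longrightarrow> slot_tuple d (\<lambda>_. 1) (\<lambda>_. 2) \<psi> i \<in> index_tuples (2 * d) n"
    and "i \<in> index_tuples (2 * d) n \<Longrightarrow> slot_tuple d (\<lambda>j. 2 * j - 1) (\<lambda>j. 2 * j) \<psi> i \<in> index_tuples (2 * d) n"
    and "i \<in> index_tuples (d + 1) n \<Longrightarrow> slot_tuple d (\<lambda>_. 1) (\<lambda>j. j + 1) \<psi> i \<in> index_tuples (2 * d) n"
  by (rule slot_tuple_in[OF _ assms]; force)+

lemma dHSIC_permuted_integrable:
  assumes "\<psi> \<in> permutation_vectors d n"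
  shows "integrable M (\<lambda>\<omega>. dHSIC_hat d k n (permuted_data \<psi> (\<lambda>m. Xs m \<omega>)))"
  unfolding dHSIC_hat_permuted
  by (intro Bochner_Integration.integrable_add Bochner_Integration.integrable_diff
      integrable_mult_right Bochner_Integration.integrable_sum slot_product_integrable(1)[where n = n] slot_tuple_index[OF assms])

lemma dHSIC_integrable: "integrable M (\<lambda>\<omega>. dHSIC_hat d k n (\<lambda>m. Xs m \<omega>))"
  using dHSIC_permuted_integrable[OF identity_permutation_vector]
  unfolding dHSIC_hat_identity_permutation .

lemma dHSIC_permuted_expectation:
  assumes "\<psi> \<in> permutation_vectors d n"
  defines "E \<equiv> \<lambda>t. \<integral>\<omega>. slot_product d k (\<lambda>m. Xs m \<omega>) t \<partial>M"
  shows "(\<integral>\<omega>. dHSIC_hat d k n (permuted_data \<psi> (\<lambda>m. Xs m \<omega>)) \<partial>M) =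
     1 / real n ^ 2 * (\<Sum>i\<in>index_tuples 2 n. E (slot_tuple d (\<lambda>_. 1) (\<lambda>_. 2) \<psi> i))
   + 1 / real n ^ (2 * d) * (\<Sum>i\<in>index_tuples (2 * d) n.
       E (slot_tuple d (\<lambda>j. 2 * j - 1) (\<lambda>j. 2 * j) \<psi> i))
   - 2 / real n ^ (d + 1) * (\<Sum>i\<in>index_tuples (d + 1) n.
       E (slot_tuple d (\<lambda>_. 1) (\<lambda>j. j + 1) \<psi> i))"
proof -
  have I: "integrable M (\<lambda>\<omega>. c * (\<Sum>i\<in>A. slot_product d k (\<lambda>m. Xs m \<omega>) (t i)))"
    "(\<integral>\<omega>. c * (\<Sum>i\<in>A. slot_product d k (\<lambda>m. Xs m \<omega>) (t i)) \<partial>M) = c * (\<Sum>i\<in>A. E (t i))"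
    if "\<And>i. i \<in> A \<Longrightarrow> t i \<in> index_tuples (2 * d) n" for A :: "(nat \<Rightarrow> nat) set" and t c
  proof -
    have i: "integrable M (\<lambda>\<omega>. slot_product d k (\<lambda>m. Xs m \<omega>) (t i))" if "i \<in> A" for i
      by (rule slot_product_integrable(1)) (fact \<open>\<And>i. i \<in> A \<Longrightarrow> t i \<in> index_tuples (2 * d) n\<close>[OF that])
    show "integrable M (\<lambda>\<omega>. c * (\<Sum>i\<in>A. slot_product d k (\<lambda>m. Xs m \<omega>) (t i)))"
      by (intro integrable_mult_right Bochner_Integration.integrable_sum i)
    show "(\<integral>\<omega>. c * (\<Sum>i\<in>A. slot_product d k (\<lambda>m. Xs m \<omega>) (t i)) \<partial>M) = c * (\<Sum>i\<in>A. E (t i))"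
      using i by (simp add: E_def)
  qed
  note a = slot_tuple_index[OF assms(1)]
  show ?thesis
    unfolding dHSIC_hat_permuted
    apply (subst Bochner_Integration.integral_diff)
      apply (intro Bochner_Integration.integrable_add I(1) a, assumption, assumption)
     apply (intro I(1) a, assumption)
    apply (subst Bochner_Integration.integral_add)
      apply (intro I(1) a, assumption)
     apply (intro I(1) a, assumption)
    by (simp only: I(2)[OF a(1)] I(2)[OF a(2)] I(2)[OF a(3)])
qed

lemma permuted_data_component:
  assumes "\<psi> \<in> permutation_vectors d n" "\<omega> \<in> space M" "i \<in> {1..n}" "j \<in> {1..d}"
  shows "permuted_data \<psi> (\<lambda>m. Xs m \<omega>) i j \<in> S j"
  unfolding permuted_data_eq
  using perm_index_in[OF assms(1,4,3)] by (intro Xs_component assms) auto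

lemma is_rkhs_tensor: obtains H ip where "is_rkhs (PiE {1..d} S) (tensor_kernel d k) H ip"
  using characteristic unfolding characteristic_kernel_def space_\<Omega> by blast

lemma dHSIC_permuted_nonneg:
  assumes "\<psi> \<in> permutation_vectors d n" "\<omega> \<in> space M"
  shows "0 \<le> dHSIC_hat d k n (permuted_data \<psi> (\<lambda>m. Xs m \<omega>))"
proof -
  obtain H ip where "is_rkhs (PiE {1..d} S) (tensor_kernel d k) H ip" by (rule is_rkhs_tensor)
  then show ?thesis by (rule dHSIC_hat_nonneg) (rule permuted_data_component[OF assms])
qed

text \<open>The conditional mean, given the data, of the statistic for a uniformly drawn
  \<open>\<psi>\<close>.\<close>

definition mean_permuted :: "nat \<Rightarrow> 'w \<Rightarrow> real" where
  "mean_permuted n \<omega> = perm_avg d n (\<lambda>\<psi>. dHSIC_hat d k n (permuted_data \<psi> (\<lambda>m. Xs m \<omega>)))"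

lemma mean_permuted_integrable: "integrable M (mean_permuted n)"
  unfolding mean_permuted_def[abs_def] perm_avg_def
  by (intro integrable_mult_right Bochner_Integration.integrable_sum dHSIC_permuted_integrable)

lemma mean_permuted_nonneg: "\<omega> \<in> space M \<Longrightarrow> 0 \<le> mean_permuted n \<omega>"
  unfolding mean_permuted_def perm_avg_def
  by (intro mult_nonneg_nonneg sum_nonneg dHSIC_permuted_nonneg) auto

lemma mean_permuted_expectation_le:
  assumes n: "n \<ge> 2 * d"
  shows "expectation (mean_permuted n) \<le> 8 * C * (2 * d)\<^sup>2 / n"
proof -
  define E where "E t = (\<integral>\<omega>. slot_product d k (\<lambda>m. Xs m \<omega>) t \<partial>M)" for t
  obtain a where a: "\<And>n t. t \<in> index_tuples (2 * d) n \<Longrightarrow> inj_on t {1..2*d} \<Longrightarrow> E t = a"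
    using slot_product_expectation_const unfolding E_def by metis
  have bound: "\<bar>E t\<bar> \<le> C" if "t \<in> index_tuples (2 * d) n" for t
  proof -
    have "\<bar>E t\<bar> \<le> (\<integral>\<omega>. \<bar>slot_product d k (\<lambda>m. Xs m \<omega>) t\<bar> \<partial>M)"
      unfolding E_def by (rule integral_abs_bound)
    then show ?thesis using slot_product_integrable(2)[OF that] by linarith
  qed
  \<comment> \<open>As \<open>n \<ge> 2 * d\<close>, an injective tuple exists; it transfers the
    bound \<open>C\<close> to the constant \<open>a\<close>.\<close>
  let ?t = "\<lambda>m\<in>{1..2*d}. m"
  have t: "?t \<in> index_tuples (2 * d) n" "inj_on ?t {1..2*d}"
    using n by (auto simp: index_tuples_def inj_on_def)
  have aC: "\<bar>a\<bar> \<le> C" using bound[OF t(1)] a[OF t] by simp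
  have "expectation (mean_permuted n) =
      perm_avg d n (\<lambda>\<psi>. \<integral>\<omega>. dHSIC_hat d k n (permuted_data \<psi> (\<lambda>m. Xs m \<omega>)) \<partial>M)"
    unfolding mean_permuted_def[abs_def] perm_avg_def by (simp add: dHSIC_permuted_integrable)
  also have "\<dots> = perm_avg d n (\<lambda>\<psi>. 1 / real n ^ 2 * (\<Sum>i\<in>index_tuples 2 n. E (slot_tuple d (\<lambda>_. 1) (\<lambda>_. 2) \<psi> i))
   + 1 / real n ^ (2 * d) * (\<Sum>i\<in>index_tuples (2 * d) n.
       E (slot_tuple d (\<lambda>j. 2 * j - 1) (\<lambda>j. 2 * j) \<psi> i))
   - 2 / real n ^ (d + 1) * (\<Sum>i\<in>index_tuples (d + 1) n.
       E (slot_tuple d (\<lambda>_. 1) (\<lambda>j. j + 1) \<psi> i)))"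
    unfolding perm_avg_def E_def by (intro arg_cong2[where f = "(*)"] refl sum.cong dHSIC_permuted_expectation)
  also have "\<dots> \<le> 8 * C * (2 * d)\<^sup>2 / n"
    by (rule perm_avg_dHSIC_le[OF _ _ bound a aC]) (use d n in auto)
  finally show ?thesis .
qed

section \<open>Lower bound for the estimator under dependence\<close>

lemma average_converges:
  assumes f: "f \<in> borel_measurable \<Omega>" and b: "\<And>y. y \<in> space \<Omega> \<Longrightarrow> \<bar>f y\<bar> \<le> b" and e: "e > 0"
  shows "(\<lambda>n. prob {\<omega> \<in> space M. \<bar>(\<Sum>i\<in>{1..n}. f (Xs i \<omega>)) / n - expectation (\<lambda>\<omega>. f (X \<omega>))\<bar> \<ge> e})
    \<longlonglongrightarrow> 0"
proof -
  \<comment> \<open>The summand \<open>1\<close> keeps the interval from \<open>- ?c\<close> to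
    \<open>?c\<close> nondegenerate even for \<open>b = 0\<close>, so the exponent in Hoeffding's
    bound has a positive denominator.\<close>
  let ?c = "\<bar>b\<bar> + 1"
  have bnd: "prob {\<omega> \<in> space M. \<bar>(\<Sum>i\<in>{1..n}. f (Xs i \<omega>)) / n - expectation (\<lambda>\<omega>. f (X \<omega>))\<bar> \<ge> e}
      \<le> 2 * exp (-2 * n * e\<^sup>2 / (?c - (- ?c))\<^sup>2)" if n: "n \<ge> 1" for n
  proof -
    interpret H: Hoeffding_ineq_iid M "{1..n}" "\<lambda>i \<omega>. f (Xs i \<omega>)" "\<lambda>\<omega>. f (X \<omega>)" "- ?c" ?c
      "expectation (\<lambda>\<omega>. f (X \<omega>))"
    proof unfold_locales
      show "indep_vars (\<lambda>_. borel) (\<lambda>i \<omega>. f (Xs i \<omega>)) {1..n}"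
        by (rule indep_vars_compose2[OF indep_vars_subset[OF indep] f]) auto
      show "distr M borel (\<lambda>\<omega>. f (Xs i \<omega>)) = distr M borel (\<lambda>\<omega>. f (X \<omega>))" if "i \<in> {1..n}" for i
      proof -
        have "i \<ge> 1" using that by simp
        then show ?thesis
          using distr_distr[OF f Xs_measurable, of i] distr_distr[OF f X] ident[of i] by (simp add: o_def)
      qed
      show "random_variable borel (\<lambda>\<omega>. f (X \<omega>))" by (rule measurable_compose[OF X f])
      show "AE \<omega> in M. f (X \<omega>) \<in> {- ?c..?c}"
      proof (rule AE_I2)
        fix \<omega> assume "\<omega> \<in> space M"
        then have "\<bar>f (X \<omega>)\<bar> \<le> b" by (intro b measurable_space[OF X])
        then show "f (X \<omega>) \<in> {- ?c..?c}" by auto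
      qed
    qed auto
    show ?thesis using H.Hoeffding_ineq_abs_ge'[of e] e n by simp
  qed
  have "(\<lambda>n. 2 * exp (-2 * real n * e\<^sup>2 / (?c - (- ?c))\<^sup>2)) \<longlonglongrightarrow> 0"
  proof -
    define r where "r = 2 * e\<^sup>2 / (?c - (- ?c))\<^sup>2"
    have r: "r > 0" unfolding r_def using e by (intro divide_pos_pos) auto
    have "(\<lambda>n. 2 * exp (- r * real n)) \<longlonglongrightarrow> 0" using r by real_asymp
    then show ?thesis by (simp add: r_def mult_ac)
  qed
  note lim = this
  show ?thesis
    by (rule tendsto_sandwich[OF _ _ tendsto_const lim])
      (simp, rule eventually_mono[OF eventually_ge_at_top[of 1] bnd])
qed

text \<open>Testing the difference of embeddings at a point \<open>x\<close> where it does not vanish avoids any law of large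
  numbers for the full V-statistic: only averages of bounded sections \<open>k j (x j)\<close> occur.\<close>

lemma embeddings_differ:
  obtains x where "x \<in> PiE {1..d} S" "tensor_kernel d k x x > 0"
    "tensor_kernel d k x \<in> borel_measurable \<Omega>"
    "expectation (\<lambda>\<omega>. tensor_kernel d k x (X \<omega>)) \<noteq> (\<Prod>j\<in>{1..d}. expectation (\<lambda>\<omega>. k j (x j) (X \<omega> j)))"
proof -
  obtain H ip where rk: "is_rkhs (space \<Omega>) (tensor_kernel d k) H ip"
    and emb: "\<And>P. prob_space P \<Longrightarrow> sets P = sets \<Omega> \<Longrightarrow> \<exists>\<mu>. mean_embedding H ip P \<mu>"
    and char: "\<And>P Q \<mu> \<nu>. prob_space P \<Longrightarrow> sets P = sets \<Omega> \<Longrightarrow> prob_space Q \<Longrightarrow> sets Q = sets \<Omega> \<Longrightarrow>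
            mean_embedding H ip P \<mu> \<Longrightarrow> mean_embedding H ip Q \<nu> \<Longrightarrow>
            (sqrt (ip (\<lambda>x. \<mu> x - \<nu> x) (\<lambda>x. \<mu> x - \<nu> x)) = 0 \<longleftrightarrow> P = Q)"
    using characteristic unfolding characteristic_kernel_def by blast
  interpret R: rkhs "space \<Omega>" "tensor_kernel d k" H ip by standard (rule rk)
  define N where "N j = (if j \<in> {1..d} then distr M (B j) (\<lambda>\<omega>. X \<omega> j) else return (count_space UNIV) undefined)" for j
  have Np: "prob_space (N j)" for j
    by (cases "j \<in> {1..d}") (simp_all add: N_def prob_space_distr prob_space_return X_component_measurable del: One_nat_def)
  interpret N: product_sigma_finite N
    by (intro product_sigma_finite.intro prob_space_imp_sigma_finite Np)
  let ?N = "PiM {1..d} N"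
  have N_eq: "?N = PiM {1..d} (\<lambda>j. distr M (B j) (\<lambda>\<omega>. X \<omega> j))"
    by (intro PiM_cong) (auto simp: N_def)
  have setsN: "sets ?N = sets \<Omega>" by (intro sets_PiM_cong) (auto simp: N_def)
  have pN: "prob_space ?N" by (intro prob_space_PiM Np)
  have setsP: "sets P = sets \<Omega>" by (simp add: P_def)
  obtain \<mu> \<nu> where \<mu>: "mean_embedding H ip P \<mu>" and \<nu>: "mean_embedding H ip ?N \<nu>"
    using emb[OF prob_space_P setsP] emb[OF pN setsN] by blast
  have \<mu>H: "\<mu> \<in> H" and \<nu>H: "\<nu> \<in> H" using \<mu> \<nu> by (auto simp: mean_embedding_def)
  have "P \<noteq> ?N" using dependent unfolding N_eq P_def .
  then have nz: "ip (\<lambda>x. \<mu> x - \<nu> x) (\<lambda>x. \<mu> x - \<nu> x) \<noteq> 0"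
    using char[OF prob_space_P setsP pN setsN \<mu> \<nu>] by auto
  then have "\<mu> \<noteq> \<nu>" using R.ip_zero by auto
  then obtain x where ne: "\<mu> x \<noteq> \<nu> x" by blast
  have x: "x \<in> space \<Omega>" using ne R.outside[OF \<mu>H] R.outside[OF \<nu>H] by metis
  have xE: "x \<in> PiE {1..d} S" using x unfolding space_\<Omega> .
  \<comment> \<open>A nonzero value at \<open>x\<close> forces a nonzero section at
    \<open>x\<close>, by \<open>eval_le\<close> for the difference of the embeddings.\<close>
  have kxx: "tensor_kernel d k x x > 0"
  proof -
    have "(\<mu> x - \<nu> x)\<^sup>2 \<le> ip (\<lambda>x. \<mu> x - \<nu> x) (\<lambda>x. \<mu> x - \<nu> x) * tensor_kernel d k x x"
      by (rule R.eval_le[OF R.diff_in[OF \<mu>H \<nu>H] x])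
    moreover have "(\<mu> x - \<nu> x)\<^sup>2 > 0" using ne by simp
    ultimately have "0 < ip (\<lambda>x. \<mu> x - \<nu> x) (\<lambda>x. \<mu> x - \<nu> x) * tensor_kernel d k x x" by linarith
    then show ?thesis using R.ip_nonneg[OF R.diff_in[OF \<mu>H \<nu>H]] by (simp add: zero_less_mult_iff)
  qed
  have xj: "x j \<in> S j" if "j \<in> {1..d}" for j by (rule PiE_mem[OF xE that])
  have comp: "(\<lambda>y. k j (x j) (y j)) \<in> borel_measurable \<Omega>" if "j \<in> {1..d}" for j
    by (rule measurable_compose[OF measurable_component_singleton[OF that, of B]
        section_measurable[OF that xj[OF that]]])
  have meas: "tensor_kernel d k x \<in> borel_measurable \<Omega>"
    unfolding tensor_kernel_def[abs_def] by (intro borel_measurable_prod comp)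
  let ?s = "kernel_section (space \<Omega>) (tensor_kernel d k) x"
  note s = R.section_in[OF x]
  have "\<mu> x = (\<integral>y. ?s y \<partial>P)"
    using \<mu> s R.ip_sym[OF \<mu>H s] R.reproducing[OF x \<mu>H] by (simp add: mean_embedding_def)
  also have "\<dots> = (\<integral>y. tensor_kernel d k x y \<partial>P)"
    by (intro Bochner_Integration.integral_cong refl) (simp add: kernel_section_def P_def)
  also have "\<dots> = expectation (\<lambda>\<omega>. tensor_kernel d k x (X \<omega>))"
    unfolding P_def by (rule integral_distr[OF X meas])
  finally have 1: "\<mu> x = expectation (\<lambda>\<omega>. tensor_kernel d k x (X \<omega>))" .
  have "\<nu> x = (\<integral>y. ?s y \<partial>?N)"
    using \<nu> s R.ip_sym[OF \<nu>H s] R.reproducing[OF x \<nu>H] by (simp add: mean_embedding_def)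
  also have "\<dots> = (\<integral>y. (\<Prod>j\<in>{1..d}. k j (x j) (y j)) \<partial>?N)"
    using sets_eq_imp_space_eq[OF setsN]
    by (intro Bochner_Integration.integral_cong refl) (simp add: kernel_section_def tensor_kernel_def)
  \<comment> \<open>Fubini for the product of the marginals; each factor is integrable because
    sections are bounded.\<close>
  also have "\<dots> = (\<Prod>j\<in>{1..d}. integral\<^sup>L (N j) (k j (x j)))"
  proof (rule N.product_integral_prod)
    fix j assume j: "j \<in> {1..d}"
    obtain b where b: "\<And>y. y \<in> S j \<Longrightarrow> \<bar>k j (x j) y\<bar> \<le> b" using section_bounded[OF j xj[OF j]] by blast
    have Nj: "N j = distr M (B j) (\<lambda>\<omega>. X \<omega> j)" using j by (simp add: N_def)
    interpret Nj: prob_space "N j" by (rule Np)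
    have "k j (x j) \<in> borel_measurable (N j)"
      unfolding Nj using section_measurable[OF j xj[OF j]] by simp
    then show "integrable (N j) (k j (x j))"
      by (intro Nj.integrable_const_bound[where B = b] AE_I2) (use b in \<open>simp_all add: Nj\<close>)
  qed simp
  also have "\<dots> = (\<Prod>j\<in>{1..d}. expectation (\<lambda>\<omega>. k j (x j) (X \<omega> j)))"
  proof (rule prod.cong[OF refl])
    fix j assume j: "j \<in> {1..d}"
    have Nj: "N j = distr M (B j) (\<lambda>\<omega>. X \<omega> j)" using j by (simp add: N_def)
    show "integral\<^sup>L (N j) (k j (x j)) = expectation (\<lambda>\<omega>. k j (x j) (X \<omega> j))"
      unfolding Nj by (rule integral_distr[OF X_component_measurable[OF j] section_measurable[OF j xj[OF j]]])
  qed
  finally have 2: "\<nu> x = (\<Prod>j\<in>{1..d}. expectation (\<lambda>\<omega>. k j (x j) (X \<omega> j)))" .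
  show thesis using that[OF xE kxx meas] ne unfolding 1 2 .
qed

text \<open>Outside finitely many events of vanishing probability, the empirical embedding
  difference at \<open>x\<close> is at least half its population value \<open>c\<close>, and
  \<open>dHSIC_hat_lower\<close> converts this into \<open>\<delta>\<close>.\<close>

lemma dHSIC_bounded_below:
  obtains \<delta> where "\<delta> > 0"
    "(\<lambda>n. prob {\<omega> \<in> space M. dHSIC_hat d k n (\<lambda>m. Xs m \<omega>) < \<delta>}) \<longlonglongrightarrow> 0"
proof -
  obtain x where x: "x \<in> PiE {1..d} S" and kxx: "tensor_kernel d k x x > 0"
    and meas: "tensor_kernel d k x \<in> borel_measurable \<Omega>"
    and ne: "expectation (\<lambda>\<omega>. tensor_kernel d k x (X \<omega>)) \<noteq> (\<Prod>j\<in>{1..d}. expectation (\<lambda>\<omega>. k j (x j) (X \<omega> j)))"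
    by (rule embeddings_differ)
  define m0 where "m0 = expectation (\<lambda>\<omega>. tensor_kernel d k x (X \<omega>))"
  define m where "m j = expectation (\<lambda>\<omega>. k j (x j) (X \<omega> j))" for j
  define c where "c = \<bar>m0 - (\<Prod>j\<in>{1..d}. m j)\<bar>"
  have c: "c > 0" using ne by (simp add: c_def m0_def m_def)
  define \<delta> where "\<delta> = (c / 2)\<^sup>2 / tensor_kernel d k x x"
  have \<delta>: "\<delta> > 0" using c kxx by (simp add: \<delta>_def)
  have xj: "x j \<in> S j" if "j \<in> {1..d}" for j by (rule PiE_mem[OF x that])
  \<comment> \<open>An error of \<open>c / 4\<close> for the joint average and one of
    \<open>c / 4\<close> for the product of marginal averages leave \<open>c / 2\<close>, the value
    used in \<open>\<delta>\<close>.\<close>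
  obtain \<eta> where \<eta>: "\<eta> > 0"
    "\<And>a. (\<And>j. j \<in> {1..d} \<Longrightarrow> \<bar>a j - m j\<bar> < \<eta>) \<Longrightarrow> \<bar>(\<Prod>j\<in>{1..d}. a j) - (\<Prod>j\<in>{1..d}. m j)\<bar> < c / 4"
    using prod_continuity_modulus[of "{1..d}" "c / 4" m] c by auto
  have "\<exists>b. \<forall>y\<in>S j. \<bar>k j (x j) y\<bar> \<le> b" if "j \<in> {1..d}" for j
    using section_bounded[OF that xj[OF that]] by metis
  then obtain b where b: "\<And>j y. j \<in> {1..d} \<Longrightarrow> y \<in> S j \<Longrightarrow> \<bar>k j (x j) y\<bar> \<le> b j" by metis
  define A0 where "A0 n \<omega> = (\<Sum>i\<in>{1..n}. tensor_kernel d k x (Xs i \<omega>)) / real n" for n \<omega>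
  define A where "A j n \<omega> = (\<Sum>i\<in>{1..n}. k j (x j) (Xs i \<omega> j)) / real n" for j n \<omega>
  define U0 where "U0 n = {\<omega> \<in> space M. \<bar>A0 n \<omega> - m0\<bar> \<ge> c / 4}" for n
  define U where "U j n = {\<omega> \<in> space M. \<bar>A j n \<omega> - m j\<bar> \<ge> \<eta>}" for j n
  have comp: "(\<lambda>y. k j (x j) (y j)) \<in> borel_measurable \<Omega>" if "j \<in> {1..d}" for j
    by (rule measurable_compose[OF measurable_component_singleton[OF that, of B]
        section_measurable[OF that xj[OF that]]])
  have lim0: "(\<lambda>n. prob (U0 n)) \<longlonglongrightarrow> 0"
    unfolding U0_def A0_def m0_def
  proof (rule average_converges[OF meas])
    fix y assume "y \<in> space \<Omega>"
    then have y: "y \<in> PiE {1..d} S" unfolding space_\<Omega> .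
    show "\<bar>tensor_kernel d k x y\<bar> \<le> (\<Prod>j\<in>{1..d}. b j)"
      unfolding tensor_kernel_def abs_prod by (intro prod_mono conjI abs_ge_zero b PiE_mem[OF y])
  qed (use c in simp)
  have limj: "(\<lambda>n. prob (U j n)) \<longlonglongrightarrow> 0" if j: "j \<in> {1..d}" for j
    unfolding U_def A_def m_def
  proof (rule average_converges[OF comp[OF j]])
    fix y assume "y \<in> space \<Omega>"
    then have y: "y \<in> PiE {1..d} S" unfolding space_\<Omega> .
    show "\<bar>k j (x j) (y j)\<bar> \<le> b j" by (rule b[OF j PiE_mem[OF y j]])
  qed (rule \<eta>(1))
  have A0m: "A0 n \<in> borel_measurable M" for n
    unfolding A0_def by (intro borel_measurable_divide borel_measurable_sum borel_measurable_const
      measurable_compose[OF Xs_measurable meas]) auto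
  have Am: "A j n \<in> borel_measurable M" if "j \<in> {1..d}" for j n
    unfolding A_def by (intro borel_measurable_divide borel_measurable_sum borel_measurable_const
      measurable_compose[OF Xs_measurable comp[OF that]]) auto
  have U0_ev: "U0 n \<in> events" for n unfolding U0_def using A0m[of n] by measurable
  have U_ev: "U j n \<in> events" if "j \<in> {1..d}" for j n unfolding U_def using Am[OF that, of n] by measurable
  obtain H ip where rk: "is_rkhs (PiE {1..d} S) (tensor_kernel d k) H ip" by (rule is_rkhs_tensor)
  have sub: "{\<omega> \<in> space M. dHSIC_hat d k n (\<lambda>m. Xs m \<omega>) < \<delta>} \<subseteq> U0 n \<union> (\<Union>j\<in>{1..d}. U j n)" for n
  proof (rule subsetI, rule ccontr)
    fix \<omega> assume "\<omega> \<in> {\<omega> \<in> space M. dHSIC_hat d k n (\<lambda>m. Xs m \<omega>) < \<delta>}"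
      and notin: "\<omega> \<notin> U0 n \<union> (\<Union>j\<in>{1..d}. U j n)"
    then have \<omega>: "\<omega> \<in> space M" and small: "dHSIC_hat d k n (\<lambda>m. Xs m \<omega>) < \<delta>" by auto
    have "\<bar>A0 n \<omega> - m0\<bar> < c / 4" using notin \<omega> by (auto simp: U0_def)
    moreover have "\<bar>A j n \<omega> - m j\<bar> < \<eta>" if "j \<in> {1..d}" for j
    proof -
      have "\<omega> \<notin> U j n" using notin that by blast
      then show ?thesis using \<omega> by (auto simp: U_def)
    qed
    then have "\<bar>(\<Prod>j\<in>{1..d}. A j n \<omega>) - (\<Prod>j\<in>{1..d}. m j)\<bar> < c / 4" by (rule \<eta>(2))
    moreover have "c \<le> \<bar>A0 n \<omega> - m0\<bar> + \<bar>A0 n \<omega> - (\<Prod>j\<in>{1..d}. A j n \<omega>)\<bar>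
        + \<bar>(\<Prod>j\<in>{1..d}. A j n \<omega>) - (\<Prod>j\<in>{1..d}. m j)\<bar>"
      unfolding c_def by linarith
    ultimately have "c / 2 \<le> \<bar>A0 n \<omega> - (\<Prod>j\<in>{1..d}. A j n \<omega>)\<bar>" by linarith
    then have "(c / 2)\<^sup>2 \<le> \<bar>A0 n \<omega> - (\<Prod>j\<in>{1..d}. A j n \<omega>)\<bar>\<^sup>2" using c by (intro power_mono) auto
    also have "\<dots> \<le> dHSIC_hat d k n (\<lambda>m. Xs m \<omega>) * tensor_kernel d k x x"
      unfolding power2_abs A0_def A_def
      by (rule dHSIC_hat_lower[OF rk _ x]) (rule Xs_component[OF _ _ \<omega>], auto)
    finally show False using small kxx by (simp add: \<delta>_def field_simps)
  qed
  have "prob {\<omega> \<in> space M. dHSIC_hat d k n (\<lambda>m. Xs m \<omega>) < \<delta>} \<le> prob (U0 n) + (\<Sum>j\<in>{1..d}. prob (U j n))" for n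
  proof -
    have UU: "(\<Union>j\<in>{1..d}. U j n) \<in> events" by (intro sets.finite_UN finite_atLeastAtMost U_ev)
    have "prob {\<omega> \<in> space M. dHSIC_hat d k n (\<lambda>m. Xs m \<omega>) < \<delta>} \<le> prob (U0 n \<union> (\<Union>j\<in>{1..d}. U j n))"
      by (rule finite_measure_mono[OF sub sets.Un[OF U0_ev UU]])
    also have "\<dots> \<le> prob (U0 n) + prob (\<Union>j\<in>{1..d}. U j n)"
      by (rule measure_Un_le[OF U0_ev UU])
    also have "prob (\<Union>j\<in>{1..d}. U j n) \<le> (\<Sum>j\<in>{1..d}. prob (U j n))"
      by (rule measure_UNION_le[OF finite_atLeastAtMost U_ev])
    finally show ?thesis by simp
  qed
  note le = this
  have "(\<lambda>n. prob (U0 n) + (\<Sum>j\<in>{1..d}. prob (U j n))) \<longlonglongrightarrow> 0 + (\<Sum>j\<in>{1..d}. 0)"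
    by (intro tendsto_add tendsto_sum lim0 limj)
  then have lim: "(\<lambda>n. prob (U0 n) + (\<Sum>j\<in>{1..d}. prob (U j n))) \<longlonglongrightarrow> 0" by simp
  have "(\<lambda>n. prob {\<omega> \<in> space M. dHSIC_hat d k n (\<lambda>m. Xs m \<omega>) < \<delta>}) \<longlonglongrightarrow> 0"
    by (rule tendsto_sandwich[OF _ _ tendsto_const lim]) (use le in \<open>auto intro: always_eventually\<close>)
  then show thesis using \<delta> that by blast
qed

section \<open>Convergence of the p-value\<close>

text \<open>The p-value is a finite average of indicators of comparisons. Measurability of the
  compared statistics over \<open>M\<close> is taken from their integrability, since the kernels
  themselves may fail to be jointly measurable.\<close>

lemma perm_p_value_measurable: "(\<lambda>\<omega>. perm_p_value d k n (\<lambda>i. Xs i \<omega>)) \<in> borel_measurable M"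
proof -
  let ?P = "permutation_vectors d n"
  have "perm_p_value d k n (\<lambda>i. Xs i \<omega>) = 1 / fact n ^ (d - 1) *
      (\<Sum>\<psi>\<in>?P. if dHSIC_hat d k n (\<lambda>i. Xs i \<omega>) \<le> dHSIC_hat d k n (permuted_data \<psi> (\<lambda>i. Xs i \<omega>)) then 1 else 0)" for \<omega>
    unfolding perm_p_value_def
    by (simp add: sum.If_cases permutation_vectors_finite Int_def)
  moreover have "(\<lambda>\<omega>. 1 / fact n ^ (d - 1) *
      (\<Sum>\<psi>\<in>?P. if dHSIC_hat d k n (\<lambda>i. Xs i \<omega>) \<le> dHSIC_hat d k n (permuted_data \<psi> (\<lambda>i. Xs i \<omega>)) then 1 else 0 :: real))
    \<in> borel_measurable M"
    by (intro borel_measurable_times borel_measurable_const borel_measurable_sum measurable_If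
        borel_measurable_le borel_measurable_integrable[OF dHSIC_integrable]
        borel_measurable_integrable[OF dHSIC_permuted_integrable])
  ultimately show ?thesis by simp
qed

lemma perm_p_value_nonneg: "0 \<le> perm_p_value d k n D"
  by (simp add: perm_p_value_def)

text \<open>Where the statistic is at least \<open>\<delta>\<close>, a p-value above
  \<open>e\<close> forces \<open>mean_permuted n\<close> above \<open>e * \<delta>\<close>; a second
  Markov inequality, now over the data, makes this rare.\<close>

lemma perm_p_value_converges:
  assumes e: "e > 0"
  shows "(\<lambda>n. prob {\<omega> \<in> space M. e < perm_p_value d k n (\<lambda>i. Xs i \<omega>)}) \<longlonglongrightarrow> 0"
proof -
  obtain \<delta> where \<delta>: "\<delta> > 0"
    and lim: "(\<lambda>n. prob {\<omega> \<in> space M. dHSIC_hat d k n (\<lambda>m. Xs m \<omega>) < \<delta>}) \<longlonglongrightarrow> 0"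
    by (rule dHSIC_bounded_below)
  let ?K = "8 * C * (2 * d)\<^sup>2 / (e * \<delta>)"
  have le: "prob {\<omega> \<in> space M. e < perm_p_value d k n (\<lambda>i. Xs i \<omega>)} \<le>
      prob {\<omega> \<in> space M. dHSIC_hat d k n (\<lambda>m. Xs m \<omega>) < \<delta>} + ?K / n" if n: "n \<ge> 2 * d" for n
  proof -
    let ?A = "{\<omega> \<in> space M. dHSIC_hat d k n (\<lambda>m. Xs m \<omega>) < \<delta>}"
    let ?B = "{\<omega> \<in> space M. e * \<delta> \<le> mean_permuted n \<omega>}"
    have A: "?A \<in> events"
      using borel_measurable_integrable[OF dHSIC_integrable] by measurable
    have B: "?B \<in> events"
      using borel_measurable_integrable[OF mean_permuted_integrable] by measurable
    have "{\<omega> \<in> space M. e < perm_p_value d k n (\<lambda>i. Xs i \<omega>)} \<subseteq> ?A \<union> ?B"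
    proof clarify
      fix \<omega> assume \<omega>: "\<omega> \<in> space M" and big: "e < perm_p_value d k n (\<lambda>i. Xs i \<omega>)"
        and notB: "\<not> e * \<delta> \<le> mean_permuted n \<omega>"
      show "dHSIC_hat d k n (\<lambda>m. Xs m \<omega>) < \<delta>"
      proof (rule ccontr)
        assume "\<not> ?thesis"
        then have "perm_p_value d k n (\<lambda>i. Xs i \<omega>) \<le> mean_permuted n \<omega> / \<delta>"
          unfolding mean_permuted_def using \<delta> \<omega> by (intro perm_p_value_le dHSIC_permuted_nonneg) auto
        then have "perm_p_value d k n (\<lambda>i. Xs i \<omega>) * \<delta> \<le> mean_permuted n \<omega>"
          using \<delta> by (simp add: pos_le_divide_eq)
        moreover have "e * \<delta> < perm_p_value d k n (\<lambda>i. Xs i \<omega>) * \<delta>"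
          using big \<delta> by (rule mult_strict_right_mono)
        ultimately show False using notB by linarith
      qed
    qed
    then have "prob {\<omega> \<in> space M. e < perm_p_value d k n (\<lambda>i. Xs i \<omega>)} \<le> prob (?A \<union> ?B)"
      by (rule finite_measure_mono[OF _ sets.Un[OF A B]])
    also have "\<dots> \<le> prob ?A + prob ?B" by (rule measure_Un_le[OF A B])
    also have "prob ?B \<le> expectation (mean_permuted n) / (e * \<delta>)"
      by (rule integral_Markov_inequality_measure[OF mean_permuted_integrable sets.top])
        (use e \<delta> mean_permuted_nonneg in auto)
    also have "\<dots> \<le> (8 * C * (2 * d)\<^sup>2 / n) / (e * \<delta>)"
      using e \<delta> by (intro divide_right_mono mean_permuted_expectation_le[OF n]) auto
    finally show ?thesis by (simp add: field_simps)
  qed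
  have "(\<lambda>n. ?K / real n) \<longlonglongrightarrow> 0" by (rule lim_const_over_n)
  from tendsto_add[OF lim this]
  have lim': "(\<lambda>n. prob {\<omega> \<in> space M. dHSIC_hat d k n (\<lambda>m. Xs m \<omega>) < \<delta>} + ?K / n) \<longlonglongrightarrow> 0" by simp
  show ?thesis
    by (rule tendsto_sandwich[OF _ _ tendsto_const lim'])
      (simp, rule eventually_mono[OF eventually_ge_at_top[of "2 * d"] le])
qed

lemma perm_test_consistent:
  "converges_in_probability M (\<lambda>n \<omega>. perm_p_value d k n (\<lambda>i. Xs i \<omega>)) 0 \<and>
   (\<forall>\<alpha>\<in>{0<..<1}.
      (\<lambda>n. prob {\<omega> \<in> space M. perm_test_rejects \<alpha> d k n (\<lambda>i. Xs i \<omega>)}) \<longlonglongrightarrow> 1)"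
proof (intro conjI ballI)
  show "converges_in_probability M (\<lambda>n \<omega>. perm_p_value d k n (\<lambda>i. Xs i \<omega>)) 0"
    using perm_p_value_converges perm_p_value_measurable perm_p_value_nonneg
    by (simp add: converges_in_probability_def)
  fix \<alpha> :: real assume "\<alpha> \<in> {0<..<1}"
  then have "\<alpha> > 0" by simp
  \<comment> \<open>Rejection is exactly the complement of the event that the p-value exceeds
    \<open>\<alpha>\<close>, so convergence in probability at \<open>\<alpha>\<close>
    suffices.\<close>
  have "prob {\<omega> \<in> space M. perm_test_rejects \<alpha> d k n (\<lambda>i. Xs i \<omega>)} =
      1 - prob {\<omega> \<in> space M. \<alpha> < perm_p_value d k n (\<lambda>i. Xs i \<omega>)}" for n
  proof -
    have ev: "{\<omega> \<in> space M. \<alpha> < perm_p_value d k n (\<lambda>i. Xs i \<omega>)} \<in> events"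
      using perm_p_value_measurable by measurable
    have "{\<omega> \<in> space M. perm_test_rejects \<alpha> d k n (\<lambda>i. Xs i \<omega>)} =
        space M - {\<omega> \<in> space M. \<alpha> < perm_p_value d k n (\<lambda>i. Xs i \<omega>)}"
      by (auto simp: perm_test_rejects_def)
    then show ?thesis using prob_compl[OF ev] by simp
  qed
  moreover have "(\<lambda>n. 1 - prob {\<omega> \<in> space M. \<alpha> < perm_p_value d k n (\<lambda>i. Xs i \<omega>)}) \<longlonglongrightarrow> 1 - 0"
    by (intro tendsto_diff tendsto_const perm_p_value_converges \<open>\<alpha> > 0\<close>)
  ultimately show "(\<lambda>n. prob {\<omega> \<in> space M. perm_test_rejects \<alpha> d k n (\<lambda>i. Xs i \<omega>)}) \<longlonglongrightarrow> 1"
    by simp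
qed

end

theorem theorem5:
  fixes d :: nat
    and S :: "nat \<Rightarrow> 'a set"
    and \<rho> :: "nat \<Rightarrow> 'a \<Rightarrow> 'a \<Rightarrow> real"
    and k :: "nat \<Rightarrow> 'a \<Rightarrow> 'a \<Rightarrow> real"
    and M :: "'w measure"
    and X :: "'w \<Rightarrow> nat \<Rightarrow> 'a"
    and Xs :: "nat \<Rightarrow> 'w \<Rightarrow> nat \<Rightarrow> 'a"
    and C :: real
  defines "T \<equiv> \<lambda>j. Metric_space.mtopology (S j) (\<rho> j)"
  defines "B \<equiv> \<lambda>j. borel_of_topology (T j)"
  assumes d: "d \<ge> 2"
    and metric: "\<And>j. j \<in> {1..d} \<Longrightarrow> Metric_space (S j) (\<rho> j)"
    and loc_compact: "\<And>j. j \<in> {1..d} \<Longrightarrow> locally_compact_space (T j)"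
    and universal: "\<And>j. j \<in> {1..d} \<Longrightarrow> c0_universal (T j) (k j)"
    and M: "prob_space M"
    and X: "X \<in> measurable M (PiM {1..d} B)"
    and dependent: "distr M (PiM {1..d} B) X \<noteq> PiM {1..d} (\<lambda>j. distr M (B j) (\<lambda>\<omega>. X \<omega> j))"
    and indep: "prob_space.indep_vars M (\<lambda>_. PiM {1..d} B) Xs {1..}"
    and ident: "\<And>m. m \<ge> 1 \<Longrightarrow> distr M (PiM {1..d} B) (Xs m) = distr M (PiM {1..d} B) X"
    and characteristic: "characteristic_kernel (PiM {1..d} B) (tensor_kernel d k)"
    and C_pos: "C > 0"
    and moment: "\<And>n i. n \<ge> 2 * d \<Longrightarrow> i \<in> index_tuples (2 * d) n \<Longrightarrow>
          integrable M (\<lambda>\<omega>. \<Prod>j = 1..d. k j (Xs (i (2 * j - 1)) \<omega> j) (Xs (i (2 * j)) \<omega> j)) \<and>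
          (\<integral>\<omega>. \<bar>\<Prod>j = 1..d. k j (Xs (i (2 * j - 1)) \<omega> j) (Xs (i (2 * j)) \<omega> j)\<bar> \<partial>M) < C"
  shows "converges_in_probability M (\<lambda>n \<omega>. perm_p_value d k n (\<lambda>i. Xs i \<omega>)) 0 \<and>
         (\<forall>\<alpha>\<in>{0<..<1}.
            (\<lambda>n. measure M {\<omega> \<in> space M. perm_test_rejects \<alpha> d k n (\<lambda>i. Xs i \<omega>)})
              \<longlonglongrightarrow> 1)"
proof -
  interpret prob_space M by (rule M)
  interpret dependent_sample d T k M X Xs C
  proof unfold_locales
    show "metrizable_space (T j)" if "j \<in> {1..d}" for j
      unfolding T_def by (rule Metric_space.metrizable_space_mtopology[OF metric[OF that]])
    show "integrable M (\<lambda>\<omega>. slot_product d k (\<lambda>m. Xs m \<omega>) i) \<and>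
          (\<integral>\<omega>. \<bar>slot_product d k (\<lambda>m. Xs m \<omega>) i\<bar> \<partial>M) < C"
      if "n \<ge> 2 * d" "i \<in> index_tuples (2 * d) n" for n i
      unfolding slot_product_def by (rule moment[OF that])
  qed (fact universal characteristic[unfolded B_def] d X[unfolded B_def] dependent[unfolded B_def]
      indep[unfolded B_def] ident[unfolded B_def])+
  show ?thesis by (rule perm_test_consistent)
qed

end
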